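(* The class of intersection graphs of families of rays (closed half-lines) in the plane is $\chi$-bounded. That is, there exists a function $f:\mathbb{N}\to\mathbb{N}$ such that every family $\mathcal{F}$ of rays in the plane satisfies $\chi(G(\mathcal{F}))\le f(\omega(G(\mathcal{F})))$.
   Context: All families and graphs are finite. For a graph $G$, $\chi(G)$ is its chromatic number and $\omega(G)$ its clique number. A class $\mathcal{G}$ of graphs is $\chi$-bounded if there is a function $f:\mathbb{N}\to\mathbb{N}$ such that $\chi(G)\le f(\omega(G))$ for every $G\in\mathcal{G}$. For a family $\mathcal{F}$ of sets in the plane, the intersection graph $G(\mathcal{F})$ has vertex set $\mathcal{F}$, with two members adjacent if and only if they have nonempty intersection. *)

theory Defs
  imports "HOL-Analysis.Analysis" "Graph_Theory.Pair_Digraph"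
begin

text \<open>
  A finite simple graph is a \<^typ>\<open>'a pair_pre_digraph\<close> satisfying \<^const>\<open>pair_graph\<close>: a vertex set
  together with a symmetric, irreflexive edge relation, both finite.
\<close>

definition proper_colouring :: "'a pair_pre_digraph \<Rightarrow> ('a \<Rightarrow> 'c) \<Rightarrow> bool" where
  "proper_colouring G c \<longleftrightarrow> (\<forall>(u, v) \<in> parcs G. c u \<noteq> c v)"

text \<open>
  The set below is nonempty for every finite simple graph. The graph without vertices has
  chromatic number \<open>0\<close> and clique number \<open>0\<close>.
\<close>

definition chromatic_number :: "'a pair_pre_digraph \<Rightarrow> nat" where
  "chromatic_number G =
     (LEAST k. \<exists>c :: 'a \<Rightarrow> nat. c ` pverts G \<subseteq> {..<k} \<and> proper_colouring G c)"

definition clique_in :: "'a pair_pre_digraph \<Rightarrow> 'a set \<Rightarrow> bool" where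
  "clique_in G K \<longleftrightarrow> K \<subseteq> pverts G \<and> (\<forall>u\<in>K. \<forall>v\<in>K. u \<noteq> v \<longrightarrow> (u, v) \<in> parcs G)"

definition clique_number :: "'a pair_pre_digraph \<Rightarrow> nat" where
  "clique_number G = Max {card K | K. clique_in G K}"

text \<open>Meant for classes of finite simple graphs only.\<close>

definition chi_bounded :: "'a pair_pre_digraph set \<Rightarrow> bool" where
  "chi_bounded \<G> \<longleftrightarrow> (\<exists>f :: nat \<Rightarrow> nat. \<forall>G\<in>\<G>. chromatic_number G \<le> f (clique_number G))"

definition intersection_graph :: "'p set set \<Rightarrow> 'p set pair_pre_digraph" where
  "intersection_graph \<F> =
     \<lparr> pverts = \<F>, parcs = {(A, B). A \<in> \<F> \<and> B \<in> \<F> \<and> A \<noteq> B \<and> A \<inter> B \<noteq> {}} \<rparr>"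

lemma pair_graph_intersection_graph:
  assumes "finite \<F>"
  shows "pair_graph (intersection_graph \<F>)"
proof -
  have "finite {(A, B). A \<in> \<F> \<and> B \<in> \<F> \<and> A \<noteq> B \<and> A \<inter> B \<noteq> {}}"
    by (rule finite_subset[of _ "\<F> \<times> \<F>"]) (use assms in auto)
  then show ?thesis
    using assms by unfold_locales (auto simp: intersection_graph_def symmetric_def sym_def)
qed

definition ray :: "'v::real_vector set \<Rightarrow> bool" where
  "ray R \<longleftrightarrow> (\<exists>p d. d \<noteq> 0 \<and> R = {p + t *\<^sub>R d | t. t \<ge> 0})"

end

(* Up to a change of coordinates every ray points upwards, and upward rays are linearly ordered by
   their positions at infinity. In this order two rays p before q meet iff p is not to the left of q
   at the height of the higher of the two apices. The combinatorial consequences of this criterion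
   bound the chromatic number by induction on the clique number k; the induction hypothesis makes
   neighbourhoods boundedly colourable. Layers of breadth-first search yield large families
   supported by other rays, and each such family contains a large family supported in one of four
   ways: by rays that all come from the right (left) of the family, or by rays acting as disjoint
   walls, such that every member meets the nearest wall to its left (right). Iterating five times,
   one of the four ways occurs twice. In a family of large chromatic number there is a k-clique
   y_1, ..., y_k with many members between consecutive elements, and two supports of the same kind
   reaching the gap between y_1 and y_2 meet each other and all of y_2, ..., y_k, which is a clique
   of size k + 1. *)

theory Submission
  imports Defs
begin

text \<open>The obstacle is that a support found by the search may start inside the region enclosed
  by two meeting rays u and v, next to the rays it supports, so it need not come from outside. It
  must still meet u or v, because the search starts outside that region. The inner supports that
  meet v lie in one neighbourhood, hence are c-colourable by the induction hypothesis, and splitting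
  by their colour produces the disjoint walls. Repeating a kind of support helps because the later
  supports are themselves members of the earlier family, so that an earlier support can be made to
  meet a later one; this meeting pair replaces y_1. No single upward direction suits a whole family,
  so four coordinate directions are treated separately and their palettes are added, which
  multiplies the bound by 4.\<close>

section \<open>Colourability of sets with respect to a binary relation\<close>

definition colourable_in :: "('a \<Rightarrow> 'a \<Rightarrow> bool) \<Rightarrow> 'a set \<Rightarrow> nat \<Rightarrow> bool" where
  "colourable_in E A n \<longleftrightarrow>
     (\<exists>f :: 'a \<Rightarrow> nat. (\<forall>a\<in>A. f a < n) \<and> (\<forall>a\<in>A. \<forall>b\<in>A. E a b \<longrightarrow> f a \<noteq> f b))"

definition is_clique :: "('a \<Rightarrow> 'a \<Rightarrow> bool) \<Rightarrow> 'a set \<Rightarrow> bool" where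
  "is_clique E K \<longleftrightarrow> (\<forall>u\<in>K. \<forall>v\<in>K. u \<noteq> v \<longrightarrow> E u v)"

lemma is_clique_subset: "is_clique E K \<Longrightarrow> K' \<subseteq> K \<Longrightarrow> is_clique E K'"
  unfolding is_clique_def by blast

lemma colourable_mono:
  assumes "colourable_in E B n" "A \<subseteq> B" "n \<le> m"
  shows "colourable_in E A m"
proof -
  obtain f :: "'a \<Rightarrow> nat"
    where f: "\<forall>a\<in>B. f a < n" "\<forall>a\<in>B. \<forall>b\<in>B. E a b \<longrightarrow> f a \<noteq> f b"
    using assms(1) unfolding colourable_in_def by blast
  have "\<forall>a\<in>A. f a < m" using f(1) assms(2,3) by (meson less_le_trans subsetD)
  moreover have "\<forall>a\<in>A. \<forall>b\<in>A. E a b \<longrightarrow> f a \<noteq> f b" using f(2) assms(2) by blast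
  ultimately show ?thesis unfolding colourable_in_def by blast
qed

lemma not_colourable_mono:
  "\<not> colourable_in E A n \<Longrightarrow> A \<subseteq> B \<Longrightarrow> m \<le> n \<Longrightarrow> \<not> colourable_in E B m"
  using colourable_mono[of E B m A n] by auto

lemma colourable_empty: "colourable_in E {} n"
  unfolding colourable_in_def by simp

lemma colourable_independent:
  "(\<And>a b. a \<in> A \<Longrightarrow> b \<in> A \<Longrightarrow> \<not> E a b) \<Longrightarrow> 1 \<le> n \<Longrightarrow> colourable_in E A n"
  unfolding colourable_in_def by (rule exI[of _ "\<lambda>_. 0"]) auto

lemma colourable_Un:
  assumes "colourable_in E A m" "colourable_in E B n"
  shows "colourable_in E (A \<union> B) (m + n)"
proof -
  obtain f g :: "'a \<Rightarrow> nat"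
    where f: "\<forall>a\<in>A. f a < m" "\<forall>a\<in>A. \<forall>b\<in>A. E a b \<longrightarrow> f a \<noteq> f b"
      and g: "\<forall>a\<in>B. g a < n" "\<forall>a\<in>B. \<forall>b\<in>B. E a b \<longrightarrow> g a \<noteq> g b"
    using assms unfolding colourable_in_def by blast
  define h where "h a = (if a \<in> A then f a else m + g a)" for a
  have "h a < m + n" if "a \<in> A \<union> B" for a
    using f(1) g(1) that unfolding h_def by (auto simp: trans_less_add1)
  moreover have "h a \<noteq> h b" if "a \<in> A \<union> B" "b \<in> A \<union> B" "E a b" for a b
  proof -
    have "f a \<noteq> m + g b" if "a \<in> A" for a b using f(1) that by (metis not_add_less1)
    then show ?thesis using f(2) g(2) that unfolding h_def by (metis Un_iff add_left_cancel)
  qed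
  ultimately show ?thesis unfolding colourable_in_def by (intro exI[of _ h]) blast
qed

lemma colourable_anticomplete_Un:
  assumes "colourable_in E A n" "colourable_in E B n"
    and "\<And>a b. a \<in> A \<Longrightarrow> b \<in> B \<Longrightarrow> \<not> E a b \<and> \<not> E b a"
  shows "colourable_in E (A \<union> B) n"
proof -
  obtain f g :: "'a \<Rightarrow> nat"
    where f: "\<forall>a\<in>A. f a < n" "\<forall>a\<in>A. \<forall>b\<in>A. E a b \<longrightarrow> f a \<noteq> f b"
      and g: "\<forall>a\<in>B. g a < n" "\<forall>a\<in>B. \<forall>b\<in>B. E a b \<longrightarrow> g a \<noteq> g b"
    using assms unfolding colourable_in_def by blast
  define h where "h a = (if a \<in> A then f a else g a)" for a
  have "\<forall>a\<in>A \<union> B. h a < n" using f(1) g(1) unfolding h_def by auto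
  moreover have "h a \<noteq> h b" if "a \<in> A \<union> B" "b \<in> A \<union> B" "E a b" for a b
    using f(2) g(2) assms(3) that unfolding h_def by (metis Un_iff)
  ultimately show ?thesis unfolding colourable_in_def by (intro exI[of _ h]) blast
qed

text \<open>Product colourings code a pair of colours (i, j) with j < n as i * n + j; together with
  \<open>mult_add_inject\<close> this bound makes the coding an injection into m * n
  colours.\<close>

lemma mult_add_less: "i < m \<Longrightarrow> j < n \<Longrightarrow> i * n + j < m * (n::nat)"
proof -
  assume "i < m" "j < n"
  then have "i * n + j < Suc i * n" by simp
  also have "\<dots> \<le> m * n" using \<open>i < m\<close> by (intro mult_right_mono) auto
  finally show ?thesis .
qed

lemma mult_add_inject:
  assumes "j < n" "j' < n" "i * n + j = i' * n + (j'::nat)"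
  shows "i = i' \<and> j = j'"
proof
  have "i = (i * n + j) div n" using assms(1) by simp
  also have "\<dots> = (i' * n + j') div n" by (simp only: assms(3))
  also have "\<dots> = i'" using assms(2) by simp
  finally show "i = i'" .
  have "j = (i * n + j) mod n" using assms(1) by simp
  also have "\<dots> = (i' * n + j') mod n" by (simp only: assms(3))
  also have "\<dots> = j'" using assms(2) by simp
  finally show "j = j'" .
qed

lemma colourable_choice:
  assumes "\<And>i. i \<in> I \<Longrightarrow> colourable_in E (F i) n"
  obtains f :: "'i \<Rightarrow> 'a \<Rightarrow> nat"
  where "\<And>i a. i \<in> I \<Longrightarrow> a \<in> F i \<Longrightarrow> f i a < n"
    and "\<And>i a b. i \<in> I \<Longrightarrow> a \<in> F i \<Longrightarrow> b \<in> F i \<Longrightarrow> E a b \<Longrightarrow> f i a \<noteq> f i b"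
proof -
  define P where "P i f \<longleftrightarrow> (\<forall>a\<in>F i. f a < n) \<and> (\<forall>a\<in>F i. \<forall>b\<in>F i. E a b \<longrightarrow> f a \<noteq> f b)"
    for i and f :: "'a \<Rightarrow> nat"
  have "\<forall>i\<in>I. \<exists>f. P i f" using assms unfolding colourable_in_def P_def by blast
  from bchoice[OF this] obtain f where f: "\<forall>i\<in>I. P i (f i)" ..
  show thesis
  proof (rule that[of f])
    show "f i a < n" if "i \<in> I" "a \<in> F i" for i a
      using bspec[OF f that(1)] that(2) unfolding P_def by blast
    show "f i a \<noteq> f i b" if "i \<in> I" "a \<in> F i" "b \<in> F i" "E a b" for i a b
      using bspec[OF f that(1)] that(2-) unfolding P_def by blast
  qed
qed

lemma colourable_classes:
  assumes "\<And>a. a \<in> A \<Longrightarrow> g a < m"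
    and "\<And>i. i < m \<Longrightarrow> colourable_in E {a \<in> A. g a = i} n"
  shows "colourable_in E A (m * n)"
proof -
  obtain f :: "nat \<Rightarrow> 'a \<Rightarrow> nat" where
    f: "\<And>i a. i \<in> {..<m} \<Longrightarrow> a \<in> {a \<in> A. g a = i} \<Longrightarrow> f i a < n"
      "\<And>i a b. i \<in> {..<m} \<Longrightarrow> a \<in> {a \<in> A. g a = i} \<Longrightarrow> b \<in> {a \<in> A. g a = i} \<Longrightarrow> E a b \<Longrightarrow>
        f i a \<noteq> f i b"
    by (rule colourable_choice[of "{..<m}" E "\<lambda>i. {a \<in> A. g a = i}" n])
       (use assms(2) in auto)
  have f_less: "f (g a) a < n" if "a \<in> A" for a using f(1)[of "g a" a] assms(1) that by simp
  have "g a * n + f (g a) a < m * n" if "a \<in> A" for a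
    using mult_add_less[OF assms(1)[OF that] f_less[OF that]] .
  moreover have "g a * n + f (g a) a \<noteq> g b * n + f (g b) b" if "a \<in> A" "b \<in> A" "E a b" for a b
  proof
    assume eq: "g a * n + f (g a) a = g b * n + f (g b) b"
    have "g a = g b \<and> f (g a) a = f (g b) b"
      by (rule mult_add_inject[OF _ _ eq]) (use f_less that in auto)
    then have g: "g b = g a" and "f (g a) a = f (g b) b" by auto
    then have "f (g a) a = f (g a) b" by simp
    then show False using f(2)[of "g a" a b] g assms(1) that by simp
  qed
  ultimately show ?thesis
    unfolding colourable_in_def by (intro exI[of _ "\<lambda>a. g a * n + f (g a) a"]) blast
qed

text \<open>Edges stay inside a layer or join consecutive ones, so distinct layers of equal parity
  are anticomplete and share one palette of m colours. The factor 2 is for the two parities.\<close>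

lemma colourable_layers:
  assumes "\<And>i. colourable_in E {a \<in> A. d a = i} m"
    and "\<And>a b. a \<in> A \<Longrightarrow> b \<in> A \<Longrightarrow> E a b \<Longrightarrow> d a \<le> Suc (d b) \<and> d b \<le> Suc (d a)"
  shows "colourable_in E A (2 * m)"
proof (rule colourable_classes[where g = "\<lambda>a. d a mod 2"])
  fix r :: nat
  obtain f :: "nat \<Rightarrow> 'a \<Rightarrow> nat" where
    f: "\<And>i a. i \<in> UNIV \<Longrightarrow> a \<in> {a \<in> A. d a = i} \<Longrightarrow> f i a < m"
      "\<And>i a b. i \<in> UNIV \<Longrightarrow> a \<in> {a \<in> A. d a = i} \<Longrightarrow> b \<in> {a \<in> A. d a = i} \<Longrightarrow> E a b \<Longrightarrow>
        f i a \<noteq> f i b"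
    by (rule colourable_choice[of UNIV E "\<lambda>i. {a \<in> A. d a = i}" m]) (use assms(1) in auto)
  have "f (d a) a \<noteq> f (d b) b" if "a \<in> A" "b \<in> A" "E a b" "d a mod 2 = d b mod 2" for a b
  proof -
    have "d a = d b" using assms(2)[OF that(1,2,3)] that(4) by presburger
    then show ?thesis using f(2)[of "d b" a b] that by simp
  qed
  moreover have "f (d a) a < m" if "a \<in> A" for a using f(1)[of "d a" a] that by simp
  ultimately show "colourable_in E {a \<in> A. d a mod 2 = r} m"
    unfolding colourable_in_def by (intro exI[of _ "\<lambda>a. f (d a) a"]) simp
qed simp

section \<open>Ordered intersection graphs of upward rays\<close>

text \<open>The order is a parameter: supports from the left are this same notion for the reversed
  order.\<close>

definition out_supported :: "('a \<Rightarrow> 'a \<Rightarrow> bool) \<Rightarrow> ('a \<Rightarrow> 'a \<Rightarrow> bool) \<Rightarrow> 'a set \<Rightarrow> 'a set \<Rightarrow> bool" where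
  "out_supported lt E A F \<longleftrightarrow> (\<exists>S\<subseteq>A. (\<forall>f\<in>F. \<exists>s\<in>S. E s f) \<and> (\<forall>f\<in>F. \<forall>s\<in>S. lt f s))"

text \<open>The form in which disjoint walls are used. The second condition, that a wall separating
  two adjacent members meets the one beyond it, is what later joins walls to the elements of a
  clique.\<close>

definition wall_supported :: "('a \<Rightarrow> 'a \<Rightarrow> bool) \<Rightarrow> ('a \<Rightarrow> 'a \<Rightarrow> bool) \<Rightarrow> 'a set \<Rightarrow> 'a set \<Rightarrow> bool" where
  "wall_supported lt E A F \<longleftrightarrow> (\<exists>S\<subseteq>A.
     (\<forall>f\<in>F. \<exists>w\<in>S. lt w f \<and> E w f \<and> (\<forall>w'\<in>S. \<not> (lt w w' \<and> lt w' f))) \<and>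
     (\<forall>a\<in>F. \<forall>b\<in>F. \<forall>w\<in>S. E a b \<longrightarrow> lt a w \<longrightarrow> lt w b \<longrightarrow> E w b))"

text \<open>
  A ray \<open>a\<close> strictly between two meeting rays \<open>u\<close> and \<open>v\<close> that meets neither is trapped: it starts
  above the meeting point and stays between them. Pairwise disjoint rays \<open>w\<close> between \<open>u\<close> and \<open>v\<close>
  that meet \<open>v\<close> act as walls for trapped rays. All assumptions are invariant under reversing the
  order.
\<close>

locale ordered_ray_graph =
  fixes V :: "'a set" and lt :: "'a \<Rightarrow> 'a \<Rightarrow> bool" (infix "\<sqsubset>" 50) and E :: "'a \<Rightarrow> 'a \<Rightarrow> bool"
  assumes finite_V: "finite V"
    and lt_irrefl: "\<not> x \<sqsubset> x"
    and lt_trans: "x \<sqsubset> y \<Longrightarrow> y \<sqsubset> z \<Longrightarrow> x \<sqsubset> z"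
    and lt_total: "x \<in> V \<Longrightarrow> y \<in> V \<Longrightarrow> x \<noteq> y \<Longrightarrow> x \<sqsubset> y \<or> y \<sqsubset> x"
    and E_sym: "E x y \<Longrightarrow> E y x"
    and E_irrefl: "\<not> E x x"
    and cross: "{a, b, c, d} \<subseteq> V \<Longrightarrow> a \<sqsubset> b \<Longrightarrow> b \<sqsubset> c \<Longrightarrow> c \<sqsubset> d \<Longrightarrow> E a c \<Longrightarrow> E b d \<Longrightarrow>
      E a b \<or> E b c \<or> E c d"
    and wall_next_right: "{u, a, w, w', v} \<subseteq> V \<Longrightarrow> u \<sqsubset> a \<Longrightarrow> a \<sqsubset> w \<Longrightarrow> w \<sqsubset> w' \<Longrightarrow> w' \<sqsubset> v \<Longrightarrow>
      E u v \<Longrightarrow> \<not> E a u \<Longrightarrow> \<not> E a v \<Longrightarrow> E w v \<Longrightarrow> E w' v \<Longrightarrow> \<not> E w w' \<Longrightarrow> E a w' \<Longrightarrow> E a w"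
    and wall_next_left: "{u, a, w, w', v} \<subseteq> V \<Longrightarrow> u \<sqsubset> w' \<Longrightarrow> w' \<sqsubset> w \<Longrightarrow> w \<sqsubset> a \<Longrightarrow> a \<sqsubset> v \<Longrightarrow>
      E u v \<Longrightarrow> \<not> E a u \<Longrightarrow> \<not> E a v \<Longrightarrow> E w u \<Longrightarrow> E w' u \<Longrightarrow> \<not> E w w' \<Longrightarrow> E a w' \<Longrightarrow> E a w"
    and wall_one_side: "{u, w, a, w', v} \<subseteq> V \<Longrightarrow> u \<sqsubset> w \<Longrightarrow> w \<sqsubset> a \<Longrightarrow> a \<sqsubset> w' \<Longrightarrow> w' \<sqsubset> v \<Longrightarrow>
      E u v \<Longrightarrow> \<not> E a u \<Longrightarrow> \<not> E a v \<Longrightarrow> E w v \<and> E w' v \<or> E w u \<and> E w' u \<Longrightarrow> \<not> E w w' \<Longrightarrow>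
      E w a \<Longrightarrow> E a w' \<Longrightarrow> False"
begin

lemma lt_asym: "x \<sqsubset> y \<Longrightarrow> \<not> y \<sqsubset> x"
  using lt_trans[of x y x] lt_irrefl by blast

lemma E_commute: "E x y \<longleftrightarrow> E y x"
  using E_sym by auto

text \<open>Halves the later case distinctions. Reversal exchanges \<open>wall_next_right\<close>
  with \<open>wall_next_left\<close> and carries \<open>cross\<close> and
  \<open>wall_one_side\<close> to themselves.\<close>

lemma mirror: "ordered_ray_graph V (\<lambda>x y. y \<sqsubset> x) E"
proof
  show "finite V" by (rule finite_V)
  show "\<not> x \<sqsubset> x" for x by (rule lt_irrefl)
  show "z \<sqsubset> x" if "y \<sqsubset> x" "z \<sqsubset> y" for x y z by (rule lt_trans[OF that(2,1)])
  show "y \<sqsubset> x \<or> x \<sqsubset> y" if "x \<in> V" "y \<in> V" "x \<noteq> y" for x y using lt_total[OF that] by auto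
  show "E y x" if "E x y" for x y by (rule E_sym[OF that])
  show "\<not> E x x" for x by (rule E_irrefl)
  show "E a b \<or> E b c \<or> E c d"
    if "{a, b, c, d} \<subseteq> V" "b \<sqsubset> a" "c \<sqsubset> b" "d \<sqsubset> c" "E a c" "E b d" for a b c d
  proof -
    have "E d c \<or> E c b \<or> E b a"
      by (rule cross) (use that in \<open>auto simp: E_commute[of d b] E_commute[of c a]\<close>)
    then show ?thesis by (auto simp: E_commute[of d c] E_commute[of c b] E_commute[of b a])
  qed
  show "E a w"
    if "{u, a, w, w', v} \<subseteq> V" "a \<sqsubset> u" "w \<sqsubset> a" "w' \<sqsubset> w" "v \<sqsubset> w'" "E u v" "\<not> E a u" "\<not> E a v"
      "E w v" "E w' v" "\<not> E w w'" "E a w'" for u a w w' v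
    by (rule wall_next_left[of v a w w' u]) (use that E_sym in auto)
  show "E a w"
    if "{u, a, w, w', v} \<subseteq> V" "w' \<sqsubset> u" "w \<sqsubset> w'" "a \<sqsubset> w" "v \<sqsubset> a" "E u v" "\<not> E a u" "\<not> E a v"
      "E w u" "E w' u" "\<not> E w w'" "E a w'" for u a w w' v
    by (rule wall_next_right[of v a w w' u]) (use that E_sym in auto)
  show False
    if "{u, w, a, w', v} \<subseteq> V" "w \<sqsubset> u" "a \<sqsubset> w" "w' \<sqsubset> a" "v \<sqsubset> w'" "E u v" "\<not> E a u" "\<not> E a v"
      "E w v \<and> E w' v \<or> E w u \<and> E w' u" "\<not> E w w'" "E w a" "E a w'" for u w a w' v
    by (rule wall_one_side[of v w' a w u]) (use that E_sym in auto)
qed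

lemma subgraph:
  assumes A: "A \<subseteq> V"
  shows "ordered_ray_graph A lt E"
proof
  show "finite A" using A finite_V finite_subset by blast
  show "\<not> x \<sqsubset> x" for x by (rule lt_irrefl)
  show "x \<sqsubset> z" if "x \<sqsubset> y" "y \<sqsubset> z" for x y z by (rule lt_trans[OF that])
  show "x \<sqsubset> y \<or> y \<sqsubset> x" if "x \<in> A" "y \<in> A" "x \<noteq> y" for x y
    by (rule lt_total) (use A that in auto)
  show "E y x" if "E x y" for x y by (rule E_sym[OF that])
  show "\<not> E x x" for x by (rule E_irrefl)
  show "E a b \<or> E b c \<or> E c d"
    if "{a, b, c, d} \<subseteq> A" "a \<sqsubset> b" "b \<sqsubset> c" "c \<sqsubset> d" "E a c" "E b d" for a b c d
    by (rule cross[OF subset_trans[OF that(1) A] that(2-)])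
  show "E a w"
    if "{u, a, w, w', v} \<subseteq> A" "u \<sqsubset> a" "a \<sqsubset> w" "w \<sqsubset> w'" "w' \<sqsubset> v"
      "E u v" "\<not> E a u" "\<not> E a v" "E w v" "E w' v" "\<not> E w w'" "E a w'" for u a w w' v
    by (rule wall_next_right[OF subset_trans[OF that(1) A] that(2-)])
  show "E a w"
    if "{u, a, w, w', v} \<subseteq> A" "u \<sqsubset> w'" "w' \<sqsubset> w" "w \<sqsubset> a" "a \<sqsubset> v"
      "E u v" "\<not> E a u" "\<not> E a v" "E w u" "E w' u" "\<not> E w w'" "E a w'" for u a w w' v
    by (rule wall_next_left[OF subset_trans[OF that(1) A] that(2-)])
  show False
    if "{u, w, a, w', v} \<subseteq> A" "u \<sqsubset> w" "w \<sqsubset> a" "a \<sqsubset> w'" "w' \<sqsubset> v" "E u v" "\<not> E a u" "\<not> E a v"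
      "E w v \<and> E w' v \<or> E w u \<and> E w' u" "\<not> E w w'" "E w a" "E a w'" for u w a w' v
    by (rule wall_one_side[OF subset_trans[OF that(1) A] that(2-)])
qed

section \<open>Least vertices and breadth-first search\<close>

lemma least_exists:
  assumes "A \<subseteq> V" "A \<noteq> {}"
  obtains r where "r \<in> A" "\<And>a. a \<in> A \<Longrightarrow> a = r \<or> r \<sqsubset> a"
proof -
  have "finite A" using assms(1) finite_V finite_subset by blast
  then have "A \<subseteq> V \<longrightarrow> (\<exists>r\<in>A. \<forall>a\<in>A. a = r \<or> r \<sqsubset> a)" using assms(2)
  proof (induction rule: finite_ne_induct)
    case (insert x A)
    show ?case
    proof
      assume sub: "insert x A \<subseteq> V"
      with insert.IH obtain r where r: "r \<in> A" "\<forall>a\<in>A. a = r \<or> r \<sqsubset> a" by auto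
      have "x \<sqsubset> r \<or> r \<sqsubset> x" using lt_total[of x r] sub r(1) insert.hyps by auto
      then show "\<exists>r\<in>insert x A. \<forall>a\<in>insert x A. a = r \<or> r \<sqsubset> a"
      proof
        assume "x \<sqsubset> r"
        then have "\<forall>a\<in>A. x \<sqsubset> a" using r(2) lt_trans[of x r] by auto
        then show ?thesis by (intro bexI[of _ x]) auto
      next
        assume "r \<sqsubset> x"
        then show ?thesis using r by (intro bexI[of _ r]) auto
      qed
    qed
  qed auto
  with assms(1) obtain r where r: "r \<in> A" "\<forall>a\<in>A. a = r \<or> r \<sqsubset> a" by auto
  show thesis by (rule that[OF r(1)]) (use r(2) in auto)
qed

text \<open>
  The second condition is all that is needed of the planarity argument that members of \<open>S\<close> can
  leave the region enclosed by an edge of \<open>F\<close>.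
\<close>

definition guards :: "'a set \<Rightarrow> 'a set \<Rightarrow> bool" where
  "guards S F \<longleftrightarrow> (\<forall>f\<in>F. \<exists>s\<in>S. E s f) \<and>
     (\<forall>x\<in>F. \<forall>y\<in>F. \<forall>y'\<in>F. \<forall>s\<in>S. y \<sqsubset> x \<longrightarrow> x \<sqsubset> y' \<longrightarrow> E y y' \<longrightarrow>
        \<not> E x y \<longrightarrow> \<not> E x y' \<longrightarrow> E s x \<longrightarrow> E s y \<or> E s y')"

lemma guards_exit:
  assumes "guards S F" "x \<in> F" "y \<in> F" "y' \<in> F" "s \<in> S" "y \<sqsubset> x" "x \<sqsubset> y'" "E y y'"
    "\<not> E x y" "\<not> E x y'" "E s x"
  shows "E s y \<or> E s y'"
proof -
  have "\<forall>x\<in>F. \<forall>y\<in>F. \<forall>y'\<in>F. \<forall>s\<in>S. y \<sqsubset> x \<longrightarrow> x \<sqsubset> y' \<longrightarrow> E y y' \<longrightarrow>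
      \<not> E x y \<longrightarrow> \<not> E x y' \<longrightarrow> E s x \<longrightarrow> E s y \<or> E s y'"
    using assms(1) unfolding guards_def by (rule conjunct2)
  from bspec[OF bspec[OF bspec[OF bspec[OF this assms(2)] assms(3)] assms(4)] assms(5)]
  show ?thesis using assms(6-) by simp
qed

text \<open>On whichever side q lies, the edges p q and y y' alternate in the order, so
  \<open>cross\<close> yields a further edge between them.\<close>

lemma exit_edge:
  assumes V: "{p, q, y, y'} \<subseteq> V" and "E y y'" "E p q" "y \<sqsubset> p" "p \<sqsubset> y'"
    and q: "\<not> (y \<sqsubset> q \<and> q \<sqsubset> y')" "q \<noteq> y" "q \<noteq> y'"
  shows "E p y \<or> E p y' \<or> E q y \<or> E q y'"
proof -
  have "q \<sqsubset> y \<or> y' \<sqsubset> q" using lt_total[of q y] lt_total[of q y'] V q by auto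
  then show ?thesis
  proof
    assume "q \<sqsubset> y"
    have "E q y \<or> E y p \<or> E p y'"
      by (rule cross) (use assms \<open>q \<sqsubset> y\<close> E_sym in auto)
    then show ?thesis by (auto simp: E_commute[of y p])
  next
    assume "y' \<sqsubset> q"
    have "E y p \<or> E p y' \<or> E y' q"
      by (rule cross) (use assms \<open>y' \<sqsubset> q\<close> in auto)
    then show ?thesis by (auto simp: E_commute[of y p] E_commute[of y' q])
  qed
qed

text \<open>
  Starting the search at the least vertex puts the root outside every gap, so any path from a gap
  to the root has an edge that leaves the gap.
\<close>

lemma colourable_by_guarded:
  assumes "A \<subseteq> V" "1 \<le> m"
    and "\<And>F S. F \<subseteq> A \<Longrightarrow> S \<subseteq> A \<Longrightarrow> guards S F \<Longrightarrow> colourable_in E F m"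
  shows "colourable_in E A (2 * m)"
  using assms(1,3)
proof (induction "card A" arbitrary: A rule: less_induct)
  case less
  note AV = less.prems(1)
  have finA: "finite A" using AV finite_V finite_subset by blast
  show ?case
  proof (cases "A = {}")
    case True
    then show ?thesis by (simp add: colourable_empty)
  next
    case False
    obtain r where r: "r \<in> A" "\<And>a. a \<in> A \<Longrightarrow> a = r \<or> r \<sqsubset> a"
      using least_exists AV False by blast
    \<comment> \<open>\<open>B i\<close> is the closed ball of radius i about r; below,
      \<open>C\<close> is the component of r in A and \<open>d\<close> the distance from r.\<close>
    define B where "B = rec_nat {r} (\<lambda>_ X. X \<union> {a \<in> A. \<exists>b\<in>X. E a b})"
    have B0: "B 0 = {r}" and BS: "B (Suc i) = B i \<union> {a \<in> A. \<exists>b\<in>B i. E a b}" for i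
      by (simp_all add: B_def)
    have BA: "B i \<subseteq> A" for i
      by (induction i) (use B0 BS r in auto)
    define C where "C = (\<Union>i. B i)"
    define d where "d a = (LEAST i. a \<in> B i)" for a
    have CA: "C \<subseteq> A" using BA C_def by auto
    have rC: "r \<in> C" using B0 C_def by blast
    have dB: "a \<in> B (d a)" if "a \<in> C" for a
      using that unfolding C_def d_def by (auto intro: LeastI)
    have d_le: "d a \<le> i" if "a \<in> B i" for a i
      using that unfolding d_def by (rule Least_le)
    have nbC: "b \<in> B (Suc (d a))" if "a \<in> C" "b \<in> A" "E a b" for a b
      using dB BS that E_sym by blast
    have "colourable_in E C (2 * m)"
    proof (rule colourable_layers[where d = d])
      fix i
      show "colourable_in E {a \<in> C. d a = i} m"
      proof (cases i)
        case 0
        then have "{a \<in> C. d a = i} \<subseteq> {r}" using dB B0 by force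
        moreover have "colourable_in E {r} m"
            by (rule colourable_independent) (use E_irrefl assms(2) in auto)
          ultimately show ?thesis by (auto intro: colourable_mono)
      next
        case (Suc j)
        define F where "F = {a \<in> C. d a = i}"
        have FA: "F \<subseteq> A" using CA F_def by blast
        have F_old: "f \<notin> B j" if "f \<in> F" for f using d_le Suc that F_def by fastforce
        define S where "S = {a \<in> B j. \<exists>f\<in>F. E a f}"
        \<comment> \<open>A ray at distance less than j has no neighbour in F, which lies at
          distance j + 1. On the way from such a ray to r, which is outside every gap, an edge
          leaving the gap of y y' would by \<open>exit_edge\<close> have an end that meets y or y'.
          So the ray is not in the gap.\<close>
        have inner: "\<not> (y \<sqsubset> p \<and> p \<sqsubset> y')"
          if y: "y \<in> F" "y' \<in> F" "E y y'" and p: "p \<in> B l" "Suc l \<le> j" for y y' p l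
          using p
        proof (induction l arbitrary: p)
          case 0
          then have "p = r" using B0 by simp
          then show ?case using r(2)[of y] y(1) FA lt_asym[of y r] lt_irrefl[of r] by auto
        next
          case (Suc l)
          show ?case
          proof (cases "p \<in> B l")
            case True
            then show ?thesis using Suc by simp
          next
            case False
            then obtain q where q: "q \<in> B l" "E p q" using Suc.prems BS by blast
            have far: "\<not> E z f" if "z \<in> B n" "Suc n \<le> j" "f \<in> F" for z n f
            proof
              assume "E z f"
              then have "f \<in> B (Suc n)" using BS that FA E_sym by blast
              then have "d f \<le> Suc n" by (rule d_le)
              then show False using that \<open>i = Suc j\<close> F_def by auto
            qed
            have qn: "q \<notin> F" using q(1) Suc.prems d_le \<open>i = Suc j\<close> F_def by fastforce
            have "{p, q, y, y'} \<subseteq> V" using BA FA AV q Suc.prems y by blast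
            moreover have "\<not> E p y" "\<not> E p y'" "\<not> E q y" "\<not> E q y'"
              using far Suc.prems q y by (meson Suc_leD)+
            moreover have "\<not> (y \<sqsubset> q \<and> q \<sqsubset> y')" using Suc q by simp
            ultimately show ?thesis using exit_edge[of p q y y'] y q qn by blast
          qed
        qed
        have "guards S F"
          unfolding guards_def
        proof (intro conjI ballI impI)
          fix f assume f: "f \<in> F"
          then have "f \<in> B (Suc j)" using dB[of f] Suc F_def by simp
          then obtain b where "b \<in> B j" "E f b" using F_old[OF f] BS by blast
          then show "\<exists>s\<in>S. E s f" using f E_sym S_def by blast
        next
          fix x y y' s
          assume x: "x \<in> F" "y \<in> F" "y' \<in> F" "s \<in> S" "y \<sqsubset> x" "x \<sqsubset> y'" "E y y'"
            "\<not> E x y" "\<not> E x y'" "E s x"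
          have sB: "s \<in> B j" using x S_def by blast
          have V4: "{x, s, y, y'} \<subseteq> V" using x FA BA AV sB by blast
          have sn: "s \<noteq> y" "s \<noteq> y'" using F_old x sB by auto
          \<comment> \<open>If s is outside the gap, the edge x s leaves it and x meets neither end.
            If s is inside, its predecessor q in the search is outside by \<open>inner\<close>, so
            the edge s q leaves the gap, and q has no neighbour in F.\<close>
          show "E s y \<or> E s y'"
          proof (cases "y \<sqsubset> s \<and> s \<sqsubset> y'")
            case False
            then show ?thesis using exit_edge[of x s y y'] V4 sn x E_sym by blast
          next
            case True
            have "s \<noteq> r" using True r(2)[of y] x(2) FA lt_asym[of y r] lt_irrefl[of r] by auto
            then obtain l where l: "j = Suc l" using sB B0 by (cases j) auto
            have sl: "s \<notin> B l" using inner[OF x(2,3,7), of s l] True l by auto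
            then obtain q where q: "q \<in> B l" "E s q" using sB l BS by blast
            have "\<not> E q f" if "f \<in> F" for f
            proof
              assume "E q f"
              then have "f \<in> B j" using BS that q FA E_sym l by blast
              then show False using F_old that by blast
            qed
            moreover have "q \<noteq> y" "q \<noteq> y'" using F_old x q l BS by blast+
            moreover have "\<not> (y \<sqsubset> q \<and> q \<sqsubset> y')" using inner[OF x(2,3,7), of q l] q l by auto
            moreover have "{s, q, y, y'} \<subseteq> V" using V4 q BA AV by blast
            ultimately show ?thesis using exit_edge[of s q y y'] x q True by blast
          qed
        qed
        moreover have "S \<subseteq> A" using S_def BA by blast
        ultimately show ?thesis using less.prems(2)[of F S] FA F_def by blast
      qed
    next
      fix a b assume ab: "a \<in> C" "b \<in> C" "E a b"
      then show "d a \<le> Suc (d b) \<and> d b \<le> Suc (d a)"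
        using nbC[of a b] nbC[of b a] d_le CA E_sym by blast
    qed
    \<comment> \<open>The rest of A is anticomplete to the component C and can reuse its
      palette.\<close>
    moreover have "colourable_in E (A - C) (2 * m)"
    proof (rule less.hyps)
      show "card (A - C) < card A" using rC r(1) finA by (intro psubset_card_mono) auto
    qed (use AV less.prems(2) in blast)+
    moreover have "\<not> E a b \<and> \<not> E b a" if "a \<in> C" "b \<in> A - C" for a b
      using nbC[of a b] that E_sym unfolding C_def by blast
    ultimately have "colourable_in E (C \<union> (A - C)) (2 * m)"
      by (rule colourable_anticomplete_Un)
    then show ?thesis using CA by (simp add: Un_absorb1)
  qed
qed

section \<open>Cliques with colourful gaps\<close>

text \<open>Cut A from the left into blocks, closing each at the first element \<open>z\<close>
  where it stops being n-colourable; g numbers the blocks, and the extra colour is for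
  \<open>z\<close>. The blocks of y and y' may themselves be cut, so a difference of 2 is needed for
  a complete block strictly between them. The third clause serves the induction when y lies in the
  first block.\<close>

lemma greedy_blocks:
  assumes "A \<subseteq> V"
  shows "\<exists>g :: 'a \<Rightarrow> nat. (\<forall>i. colourable_in E {x \<in> A. g x = i} (Suc n)) \<and>
    (\<forall>y\<in>A. \<forall>y'\<in>A. y \<sqsubset> y' \<longrightarrow> g y \<le> g y') \<and>
    (\<forall>y\<in>A. 1 \<le> g y \<longrightarrow> \<not> colourable_in E {x \<in> A. x \<sqsubset> y} n) \<and>
    (\<forall>y\<in>A. \<forall>y'\<in>A. g y + 2 \<le> g y' \<longrightarrow> \<not> colourable_in E {x \<in> A. y \<sqsubset> x \<and> x \<sqsubset> y'} n)"
  using assms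
proof (induction "card A" arbitrary: A rule: less_induct)
  case less
  note AV = less.prems
  have finA: "finite A" using AV finite_V finite_subset by blast
  show ?case
  proof (cases "colourable_in E A n")
    case True
    then have "colourable_in E {x \<in> A. (0::nat) = i} (Suc n)" for i
      by (rule colourable_mono) auto
    then show ?thesis by (intro exI[of _ "\<lambda>_. 0"]) auto
  next
    case False
    define le where "le z = {x \<in> A. x = z \<or> x \<sqsubset> z}" for z
    define P where "P = {z \<in> A. \<not> colourable_in E (le z) n}"
    interpret m: ordered_ray_graph V "\<lambda>x y. y \<sqsubset> x" E by (rule mirror)
    have "A \<noteq> {}" using False colourable_empty by blast
    then obtain t where t: "t \<in> A" "\<And>a. a \<in> A \<Longrightarrow> a = t \<or> a \<sqsubset> t"
      by (rule m.least_exists[OF AV]) blast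
    have "le t = A" using t(2) unfolding le_def by auto
    then have "t \<in> P" using False t(1) P_def by simp
    then have "P \<noteq> {}" by auto
    have "P \<subseteq> V" using P_def AV by auto
    from this \<open>P \<noteq> {}\<close> obtain z where z: "z \<in> P" "\<And>a. a \<in> P \<Longrightarrow> a = z \<or> z \<sqsubset> a"
      by (rule least_exists) blast
    have zA: "z \<in> A" using z(1) P_def by simp
    \<comment> \<open>By minimality of \<open>z\<close>, the initial segment ending at its
      predecessor is still n-colourable.\<close>
    have lt_col: "colourable_in E {x \<in> A. x \<sqsubset> z} n"
    proof (cases "{x \<in> A. x \<sqsubset> z} = {}")
      case True
      then show ?thesis by (simp only: colourable_empty)
    next
      case False
      have sub: "{x \<in> A. x \<sqsubset> z} \<subseteq> V" using AV by auto
      obtain t where t: "t \<in> A" "t \<sqsubset> z" "\<And>a. a \<in> A \<Longrightarrow> a \<sqsubset> z \<Longrightarrow> a = t \<or> a \<sqsubset> t"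
        by (rule m.least_exists[OF sub False]) auto
      then have "t \<notin> P" using z(2)[of t] lt_irrefl[of z] lt_asym[of t z] by auto
      then have "colourable_in E (le t) n" using t(1) P_def by simp
      then show ?thesis by (rule colourable_mono) (use t(3) le_def in auto)
    qed
    have "colourable_in E {z} 1" by (rule colourable_independent) (use E_irrefl in auto)
    with lt_col have "colourable_in E ({x \<in> A. x \<sqsubset> z} \<union> {z}) (n + 1)"
      by (rule colourable_Un)
    then have block: "colourable_in E (le z) (Suc n)"
      by (rule colourable_mono) (auto simp: le_def)
    have notcol: "\<not> colourable_in E (le z) n" using z(1) P_def by simp
    define R where "R = A - le z"
    have Rgt: "z \<sqsubset> x" if "x \<in> R" for x
      using that lt_total[of x z] zA AV unfolding R_def le_def by auto
    have RA: "R \<subseteq> A" using R_def by blast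
    have card_R: "card R < card A" using zA finA unfolding R_def le_def by (intro psubset_card_mono) auto
    obtain g :: "'a \<Rightarrow> nat" where
      g_col: "\<forall>i. colourable_in E {x \<in> R. g x = i} (Suc n)"
      and g_mono: "\<forall>y\<in>R. \<forall>y'\<in>R. y \<sqsubset> y' \<longrightarrow> g y \<le> g y'"
      and g_pos: "\<forall>y\<in>R. 1 \<le> g y \<longrightarrow> \<not> colourable_in E {x \<in> R. x \<sqsubset> y} n"
      and g_gap: "\<forall>y\<in>R. \<forall>y'\<in>R. g y + 2 \<le> g y' \<longrightarrow>
        \<not> colourable_in E {x \<in> R. y \<sqsubset> x \<and> x \<sqsubset> y'} n"
      using less.hyps[OF card_R subset_trans[OF RA AV]] by (elim exE conjE) (rule that)
    define h where "h x = (if x \<in> R then Suc (g x) else 0)" for x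
    have leR: "x \<in> le z \<or> x \<in> R" if "x \<in> A" for x using that R_def by blast
    have ltR: "x \<sqsubset> y" if "x \<in> le z" "y \<in> R" for x y
      using that Rgt[of y] lt_trans[of x z y] unfolding le_def by auto
    show ?thesis
    proof (intro exI[of _ h] conjI allI ballI impI)
      fix i
      show "colourable_in E {x \<in> A. h x = i} (Suc n)"
      proof (cases i)
        case 0
        then have "{x \<in> A. h x = i} \<subseteq> le z" using R_def h_def by auto
        with block show ?thesis by (rule colourable_mono) simp
      next
        case (Suc j)
        then have "{x \<in> A. h x = i} \<subseteq> {x \<in> R. g x = j}" using h_def by auto
        with spec[OF g_col] show ?thesis by (rule colourable_mono) simp
      qed
    next
      fix y y' assume "y \<in> A" "y' \<in> A" "y \<sqsubset> y'"
      then show "h y \<le> h y'"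
        using g_mono ltR[of y' y] leR[of y'] lt_asym[of y y'] unfolding h_def by auto
    next
      fix y assume "y \<in> A" "1 \<le> h y"
      then have "y \<in> R" unfolding h_def by (auto split: if_splits)
      then have "le z \<subseteq> {x \<in> A. x \<sqsubset> y}" using ltR le_def by auto
      with notcol show "\<not> colourable_in E {x \<in> A. x \<sqsubset> y} n" by (rule not_colourable_mono) simp
    next
      fix y y' assume y: "y \<in> A" "y' \<in> A" "h y + 2 \<le> h y'"
      then have y'R: "y' \<in> R" unfolding h_def by (auto split: if_splits)
      show "\<not> colourable_in E {x \<in> A. y \<sqsubset> x \<and> x \<sqsubset> y'} n"
      proof (cases "y \<in> R")
        case True
        then have "\<not> colourable_in E {x \<in> R. y \<sqsubset> x \<and> x \<sqsubset> y'} n"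
          using g_gap y y'R unfolding h_def by auto
        moreover have "{x \<in> R. y \<sqsubset> x \<and> x \<sqsubset> y'} \<subseteq> {x \<in> A. y \<sqsubset> x \<and> x \<sqsubset> y'}" using RA by blast
        ultimately show ?thesis by (rule not_colourable_mono) simp
      next
        case False
        then have "\<not> colourable_in E {x \<in> R. x \<sqsubset> y'} n"
          using g_pos y y'R unfolding h_def by auto
        moreover have "{x \<in> R. x \<sqsubset> y'} \<subseteq> {x \<in> A. y \<sqsubset> x \<and> x \<sqsubset> y'}"
          using RA ltR[of y] leR[of y] False y by auto
        ultimately show ?thesis by (rule not_colourable_mono) simp
      qed
    qed
  qed
qed

section \<open>Disjoint walls in the gap of an edge\<close>

text \<open>Split F by the side on which a member meets a wall. Since all walls meet v,
  \<open>cross\<close> (on the left) and \<open>wall_next_right\<close> (on the right) pass the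
  contact on to the nearest wall. By \<open>wall_one_side\<close> no member meets walls on both
  sides, which decides which end of an edge a separating wall meets.\<close>

lemma walls_crossing_right:
  assumes V: "u \<in> V" "v \<in> V" "A \<subseteq> V" "F \<subseteq> A" "S \<subseteq> A" and uv: "E u v"
    and F: "\<And>f. f \<in> F \<Longrightarrow> u \<sqsubset> f \<and> f \<sqsubset> v \<and> \<not> E f u \<and> \<not> E f v"
    and S: "\<And>s. s \<in> S \<Longrightarrow> u \<sqsubset> s \<and> s \<sqsubset> v \<and> E s v"
    and indep: "\<And>s t. s \<in> S \<Longrightarrow> t \<in> S \<Longrightarrow> \<not> E s t"
    and sup: "\<And>f. f \<in> F \<Longrightarrow> \<exists>s\<in>S. E s f"
  shows "\<exists>F1 F2. F = F1 \<union> F2 \<and> wall_supported lt E A F1 \<and> wall_supported (\<lambda>x y. y \<sqsubset> x) E A F2"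
proof (intro exI conjI)
  define F1 where "F1 = {f \<in> F. \<exists>s\<in>S. s \<sqsubset> f \<and> E s f}"
  define F2 where "F2 = {f \<in> F. \<exists>s\<in>S. f \<sqsubset> s \<and> E s f}"
  have FV: "F \<subseteq> V" and SV: "S \<subseteq> V" using V by auto
  show "F = F1 \<union> F2"
  proof -
    have "f \<in> F1 \<or> f \<in> F2" if f: "f \<in> F" for f
    proof -
      obtain s where s: "s \<in> S" "E s f" using sup[OF f] by auto
      then have "s \<noteq> f" using E_irrefl[of f] by auto
      then have "s \<sqsubset> f \<or> f \<sqsubset> s" using lt_total[of s f] s(1) f FV SV by auto
      then show ?thesis using s f F1_def F2_def by auto
    qed
    then show ?thesis unfolding F1_def F2_def by auto
  qed
  show "wall_supported lt E A F1"
    unfolding wall_supported_def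
  proof (intro exI[of _ S] conjI ballI impI)
    show "S \<subseteq> A" by (rule V(5))
  next
    fix f assume "f \<in> F1"
    then obtain s where f: "f \<in> F" and s: "s \<in> S" "s \<sqsubset> f" "E s f" using F1_def by auto
    interpret m: ordered_ray_graph V "\<lambda>x y. y \<sqsubset> x" E by (rule mirror)
    have ne: "{w \<in> S. w \<sqsubset> f} \<noteq> {}" using s by auto
    have "{w \<in> S. w \<sqsubset> f} \<subseteq> V" using SV by auto
    from this ne obtain w where "w \<in> {w \<in> S. w \<sqsubset> f}" "\<And>t. t \<in> {w \<in> S. w \<sqsubset> f} \<Longrightarrow> t = w \<or> t \<sqsubset> w"
      by (rule m.least_exists) blast
    then have w: "w \<in> S" "w \<sqsubset> f" "\<And>t. t \<in> S \<Longrightarrow> t \<sqsubset> f \<Longrightarrow> t = w \<or> t \<sqsubset> w" by simp_all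
    have "E w f"
    proof (cases "s = w")
      case False
      then have sw: "s \<sqsubset> w" using w(3)[OF s(1,2)] by simp
      \<comment> \<open>The edges s f and w v alternate, the walls s and w are disjoint, and f does
        not meet v.\<close>
      have "E s w \<or> E w f \<or> E f v"
        by (rule cross[OF _ sw w(2) _ s(3)])
          (use F[OF f] S[OF w(1)] s(1) w(1) f SV FV V in auto)
      then show ?thesis using indep[OF s(1) w(1)] F[OF f] by auto
    qed (use s in simp)
    moreover have "\<not> (w \<sqsubset> t \<and> t \<sqsubset> f)" if "t \<in> S" for t
      using w(3)[OF that] lt_asym[of t w] lt_irrefl[of w] by auto
    ultimately show "\<exists>w\<in>S. w \<sqsubset> f \<and> E w f \<and> (\<forall>w'\<in>S. \<not> (w \<sqsubset> w' \<and> w' \<sqsubset> f))"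
      using w(1,2) by auto
  next
    fix a b w assume ab: "a \<in> F1" "b \<in> F1" "w \<in> S" "E a b" "a \<sqsubset> w" "w \<sqsubset> b"
    then obtain s where a: "a \<in> F" and s: "s \<in> S" "s \<sqsubset> a" "E s a" using F1_def by auto
    have b: "b \<in> F" using ab F1_def by auto
    have "E a w \<or> E w b \<or> E b v"
      by (rule cross[OF _ ab(5,6) _ ab(4)])
        (use F[OF b] S[OF ab(3)] a b ab(3) SV FV V in auto)
    \<comment> \<open>The ray a already meets the wall s on its left, so it cannot meet w on its
      right.\<close>
    moreover have "\<not> E a w"
    proof
      assume "E a w"
      show False
        by (rule wall_one_side[of u s a w v])
          (use F[OF a] S[OF s(1)] S[OF ab(3)] a s ab(3,5) SV FV V uv \<open>E a w\<close> indep[OF s(1) ab(3)] in auto)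
    qed
    ultimately show "E w b" using F[OF b] by auto
  qed
  show "wall_supported (\<lambda>x y. y \<sqsubset> x) E A F2"
    unfolding wall_supported_def
  proof (intro exI[of _ S] conjI ballI impI)
    show "S \<subseteq> A" by (rule V(5))
  next
    fix f assume "f \<in> F2"
    then obtain s where f: "f \<in> F" and s: "s \<in> S" "f \<sqsubset> s" "E s f" using F2_def by auto
    have ne: "{w \<in> S. f \<sqsubset> w} \<noteq> {}" using s by auto
    have "{w \<in> S. f \<sqsubset> w} \<subseteq> V" using SV by auto
    from this ne obtain w where "w \<in> {w \<in> S. f \<sqsubset> w}" "\<And>t. t \<in> {w \<in> S. f \<sqsubset> w} \<Longrightarrow> t = w \<or> w \<sqsubset> t"
      by (rule least_exists) blast
    then have w: "w \<in> S" "f \<sqsubset> w" "\<And>t. t \<in> S \<Longrightarrow> f \<sqsubset> t \<Longrightarrow> t = w \<or> w \<sqsubset> t" by simp_all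
    have "E f w"
    proof (cases "s = w")
      case False
      then have ws: "w \<sqsubset> s" using w(3)[OF s(1,2)] by simp
      show ?thesis
        by (rule wall_next_right[of u f w s v])
          (use F[OF f] S[OF w(1)] S[OF s(1)] ws s w(1,2) f SV FV V uv indep[OF w(1) s(1)]
            E_sym[OF s(3)] in auto)
    qed (use s E_sym[OF s(3)] in simp)
    then have "E w f" by (rule E_sym)
    moreover have "\<not> (t \<sqsubset> w \<and> f \<sqsubset> t)" if "t \<in> S" for t
      using w(3)[OF that] lt_asym[of t w] lt_irrefl[of w] by auto
    ultimately show "\<exists>w\<in>S. f \<sqsubset> w \<and> E w f \<and> (\<forall>w'\<in>S. \<not> (w' \<sqsubset> w \<and> f \<sqsubset> w'))"
      using w(1,2) by auto
  next
    fix a b w assume ab: "a \<in> F2" "b \<in> F2" "w \<in> S" "E a b" "w \<sqsubset> a" "b \<sqsubset> w"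
    then obtain s where a: "a \<in> F" and s: "s \<in> S" "a \<sqsubset> s" "E s a" using F2_def by auto
    have b: "b \<in> F" using ab F2_def by auto
    have "E b w \<or> E w a \<or> E a v"
      by (rule cross[OF _ ab(6,5) _ E_sym[OF ab(4)]])
        (use F[OF a] S[OF ab(3)] a b ab(3) SV FV V in auto)
    moreover have "\<not> E w a"
    proof
      assume "E w a"
      show False
        by (rule wall_one_side[of u w a s v])
          (use F[OF a] S[OF s(1)] S[OF ab(3)] a s ab(3,5) SV FV V uv \<open>E w a\<close> indep[OF ab(3) s(1)]
            E_sym[OF s(3)] in auto)
    qed
    ultimately show "E w b" using F[OF a] E_sym[of b w] by auto
  qed
qed

end

section \<open>The induction step for clique number k\<close>

text \<open>\<open>small_colourable\<close> is the induction hypothesis, available for every subset.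
  The bound 2 \<le> k ensures that a k-clique has two elements and hence a gap.\<close>

locale critical_ray_graph = ordered_ray_graph +
  fixes k c :: nat
  assumes k_ge_2: "2 \<le> k" and c_ge_1: "1 \<le> c"
    and clique_le: "K \<subseteq> V \<Longrightarrow> is_clique E K \<Longrightarrow> card K \<le> k"
    and small_colourable:
      "A \<subseteq> V \<Longrightarrow> (\<And>K. K \<subseteq> A \<Longrightarrow> is_clique E K \<Longrightarrow> card K < k) \<Longrightarrow> colourable_in E A c"
begin

lemma mirror_critical: "critical_ray_graph V (\<lambda>x y. y \<sqsubset> x) E k c"
proof (rule critical_ray_graph.intro[OF mirror critical_ray_graph_axioms.intro])
  show "2 \<le> k" "1 \<le> c" by (rule k_ge_2 c_ge_1)+
  show "card K \<le> k" if "K \<subseteq> V" "is_clique E K" for K by (rule clique_le[OF that])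
  show "colourable_in E A c"
    if "A \<subseteq> V" "\<And>K. K \<subseteq> A \<Longrightarrow> is_clique E K \<Longrightarrow> card K < k" for A
    using that by (rule small_colourable)
qed

text \<open>Adding v to a clique in its neighbourhood gives a larger clique, so the cliques there
  have fewer than k elements.\<close>

lemma neighbourhood_colourable:
  assumes "v \<in> V" "A \<subseteq> V" "\<And>a. a \<in> A \<Longrightarrow> E v a"
  shows "colourable_in E A c"
proof (rule small_colourable[OF assms(2)])
  fix K assume K: "K \<subseteq> A" "is_clique E K"
  have "finite K" by (rule finite_subset[OF subset_trans[OF K(1) assms(2)] finite_V])
  moreover have "v \<notin> K" using assms(3)[of v] K(1) E_irrefl[of v] by auto
  moreover have "E v x" "E x v" if "x \<in> K" for x
    using assms(3)[of x] E_sym[of v x] that K(1) by auto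
  then have "is_clique E (insert v K)" using K(2) unfolding is_clique_def by auto
  then have "card (insert v K) \<le> k" by (intro clique_le) (use K(1) assms in auto)
  ultimately show "card K < k" by simp
qed

lemma neighbours_of_set_colourable:
  assumes "finite U" "U \<subseteq> V" "A \<subseteq> V"
  shows "colourable_in E {x \<in> A. \<exists>u\<in>U. E x u} (card U * c)"
  using assms(1,2)
proof (induction rule: finite_induct)
  case empty
  then show ?case by (simp add: colourable_empty)
next
  case (insert u U)
  have "colourable_in E {x \<in> A. E x u} c"
    by (rule neighbourhood_colourable[of u]) (use insert.prems assms(3) E_sym in auto)
  moreover have "colourable_in E {x \<in> A. \<exists>u\<in>U. E x u} (card U * c)"
    using insert by simp
  ultimately have
    "colourable_in E ({x \<in> A. E x u} \<union> {x \<in> A. \<exists>u\<in>U. E x u}) (c + card U * c)"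
    by (rule colourable_Un)
  then show ?case by (rule colourable_mono) (use insert.hyps in auto)
qed

text \<open>Lets one pass to rays that are disjoint from finitely many given rays, at a price of c
  colours for each of these.\<close>

lemma avoid_neighbours:
  assumes "finite U" "U \<subseteq> V" "A \<subseteq> V" "\<not> colourable_in E A (n + card U * c)"
  shows "\<not> colourable_in E {x \<in> A. \<forall>u\<in>U. \<not> E x u} n"
proof
  assume "colourable_in E {x \<in> A. \<forall>u\<in>U. \<not> E x u} n"
  from colourable_Un[OF this neighbours_of_set_colourable[OF assms(1-3)]]
  have "colourable_in E A (n + card U * c)" by (rule colourable_mono) auto
  with assms(4) show False ..
qed

text \<open>Combine the parity of the block from \<open>greedy_blocks\<close> with a proper
  colouring of each block by a + 1 colours. One of these 2 * (a + 1) classes is not c-colourable and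
  so contains a k-clique. Its elements are adjacent but share the colour, so they lie in different
  blocks of equal parity, and a complete block lies between any two of them.\<close>

lemma dense_clique:
  assumes AV: "A \<subseteq> V" and notcol: "\<not> colourable_in E A (2 * (a + 1) * c)"
  obtains K where "K \<subseteq> A" "is_clique E K" "card K = k"
    "\<And>y y'. y \<in> K \<Longrightarrow> y' \<in> K \<Longrightarrow> y \<sqsubset> y' \<Longrightarrow> \<not> colourable_in E {x \<in> A. y \<sqsubset> x \<and> x \<sqsubset> y'} a"
proof -
  obtain g :: "'a \<Rightarrow> nat" where
    g_col: "\<forall>i. colourable_in E {x \<in> A. g x = i} (Suc a)"
    and g_mono: "\<forall>y\<in>A. \<forall>y'\<in>A. y \<sqsubset> y' \<longrightarrow> g y \<le> g y'"
    and g_gap: "\<forall>y\<in>A. \<forall>y'\<in>A. g y + 2 \<le> g y' \<longrightarrow>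
      \<not> colourable_in E {x \<in> A. y \<sqsubset> x \<and> x \<sqsubset> y'} a"
    using greedy_blocks[OF AV, of a] by (elim exE conjE) (rule that)
  obtain f :: "nat \<Rightarrow> 'a \<Rightarrow> nat" where
    f: "\<And>i x. i \<in> UNIV \<Longrightarrow> x \<in> {x \<in> A. g x = i} \<Longrightarrow> f i x < Suc a"
      "\<And>i x y. i \<in> UNIV \<Longrightarrow> x \<in> {x \<in> A. g x = i} \<Longrightarrow> y \<in> {x \<in> A. g x = i} \<Longrightarrow> E x y \<Longrightarrow>
        f i x \<noteq> f i y"
    by (rule colourable_choice[of UNIV E "\<lambda>i. {x \<in> A. g x = i}" "Suc a"]) (use g_col in auto)
  define h where "h x = (g x mod 2) * Suc a + f (g x) x" for x
  have f_less: "f (g x) x < Suc a" if "x \<in> A" for x using f(1)[of "g x" x] that by simp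
  have h_less: "h x < 2 * (a + 1)" if "x \<in> A" for x
    using mult_add_less[OF _ f_less[OF that], of "g x mod 2" 2] unfolding h_def by simp
  obtain i where i: "\<not> colourable_in E {x \<in> A. h x = i} c"
    using colourable_classes[of A h "2 * (a + 1)" E c] h_less notcol by auto
  then obtain K where K: "K \<subseteq> {x \<in> A. h x = i}" "is_clique E K" "\<not> card K < k"
    using small_colourable[of "{x \<in> A. h x = i}"] AV by auto
  have KA: "K \<subseteq> A" using K(1) by auto
  have "card K \<le> k" using clique_le[of K] KA AV K(2) by auto
  show thesis
  proof (rule that[OF KA K(2)])
    show "card K = k" using \<open>card K \<le> k\<close> K(3) by simp
    fix y y' assume y: "y \<in> K" "y' \<in> K" "y \<sqsubset> y'"
    have yA: "y \<in> A" "y' \<in> A" using y KA by auto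
    have "y \<noteq> y'" using y(3) lt_irrefl by auto
    then have "E y y'" using K(2) y unfolding is_clique_def by simp
    have "h y = h y'" using K(1) y by auto
    then have eq: "(g y mod 2) * Suc a + f (g y) y = (g y' mod 2) * Suc a + f (g y') y'"
      unfolding h_def .
    have par: "g y mod 2 = g y' mod 2 \<and> f (g y) y = f (g y') y'"
      by (rule mult_add_inject[OF f_less[OF yA(1)] f_less[OF yA(2)] eq])
    have "g y \<noteq> g y'"
    proof
      assume "g y = g y'"
      then have g: "g y' = g y" by simp
      then have "f (g y) y = f (g y) y'" using par by simp
      then show False using f(2)[of "g y" y y'] g yA \<open>E y y'\<close> by simp
    qed
    moreover have "g y \<le> g y'" using g_mono yA y(3) by simp
    ultimately have "g y + 2 \<le> g y'" using par by presburger
    then show "\<not> colourable_in E {x \<in> A. y \<sqsubset> x \<and> x \<sqsubset> y'} a" using g_gap yA by simp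
  qed
qed

lemma two_least:
  assumes "K \<subseteq> V" "2 \<le> card K"
  obtains y1 y2 where "y1 \<in> K" "y2 \<in> K" "y1 \<sqsubset> y2"
    "\<And>y. y \<in> K - {y1} \<Longrightarrow> y = y2 \<or> y2 \<sqsubset> y"
proof -
  have fin: "finite K" by (rule finite_subset[OF assms(1) finite_V])
  have "K \<noteq> {}" using assms(2) by auto
  with assms(1) obtain y1 where y1: "y1 \<in> K" "\<And>y. y \<in> K \<Longrightarrow> y = y1 \<or> y1 \<sqsubset> y"
    by (rule least_exists) blast
  have "card (K - {y1}) \<noteq> 0" using assms(2) y1(1) fin by simp
  then have "K - {y1} \<noteq> {}" by (metis card.empty)
  moreover have "K - {y1} \<subseteq> V" using assms(1) by auto
  ultimately obtain y2 where y2: "y2 \<in> K - {y1}" "\<And>y. y \<in> K - {y1} \<Longrightarrow> y = y2 \<or> y2 \<sqsubset> y"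
    using least_exists[of "K - {y1}"] by auto
  show thesis by (rule that[of y1 y2]) (use y1 y2 in auto)
qed

text \<open>Exchanging y1 for both p and q would give a clique with k + 1 elements; irreflexivity of
  E guarantees that p and q are new.\<close>

lemma clique_too_large:
  assumes "K \<subseteq> V" "is_clique E K" "card K = k" "y1 \<in> K" "p \<in> V" "q \<in> V" "E p q"
    and "\<And>y. y \<in> K - {y1} \<Longrightarrow> E p y \<and> E q y"
  shows False
proof -
  have fin: "finite K" by (rule finite_subset[OF assms(1) finite_V])
  have p: "p \<notin> K - {y1}" using assms(8)[of p] E_irrefl[of p] by auto
  have q: "q \<notin> K - {y1}" using assms(8)[of q] E_irrefl[of q] by auto
  have "p \<noteq> q" using assms(7) E_irrefl[of p] by auto
  have "E y p" "E y q" if "y \<in> K - {y1}" for y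
    using assms(8)[OF that] E_sym[of p y] E_sym[of q y] by auto
  moreover have "is_clique E (K - {y1})" by (rule is_clique_subset[OF assms(2)]) auto
  ultimately have "is_clique E (insert p (insert q (K - {y1})))"
    using assms(7) E_sym[OF assms(7)] assms(8) unfolding is_clique_def by auto
  then have "card (insert p (insert q (K - {y1}))) \<le> k"
    by (intro clique_le) (use assms(1,5,6) in auto)
  moreover have "card (insert p (insert q (K - {y1}))) = Suc (Suc (card (K - {y1})))"
    using fin p q \<open>p \<noteq> q\<close> by simp
  moreover have "Suc (card (K - {y1})) = k"
    using card_Suc_Diff1[OF fin assms(4)] assms(3) by simp
  ultimately show False by simp
qed

text \<open>The later support p of a ray x0 belongs to F, so every earlier support s lies to its
  right. For a ray z with support s in the order x0, z, p, s that avoids x0 and p,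
  \<open>cross\<close> makes p and s meet. In the constant, k * c pays for the neighbours of K, 2 *
  c for those of x0 and p, and 1 for x0 itself.\<close>

lemma not_out_supported_twice:
  assumes FV: "F \<subseteq> V" and F': "F' \<subseteq> F"
    and "out_supported lt E V F" "out_supported lt E F F'"
  shows "colourable_in E F' (2 * ((k * c + 2 * c + 1) + 1) * c)"
proof (rule ccontr)
  assume notcol: "\<not> ?thesis"
  have F'V: "F' \<subseteq> V" using FV F' by blast
  obtain S where S: "S \<subseteq> V" "\<forall>f\<in>F. \<exists>s\<in>S. E s f" "\<forall>f\<in>F. \<forall>s\<in>S. f \<sqsubset> s"
    using assms(3) unfolding out_supported_def by auto
  obtain S' where S': "S' \<subseteq> F" "\<forall>f\<in>F'. \<exists>s\<in>S'. E s f" "\<forall>f\<in>F'. \<forall>s\<in>S'. f \<sqsubset> s"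
    using assms(4) unfolding out_supported_def by auto
  obtain K where K: "K \<subseteq> F'" "is_clique E K" "card K = k"
    "\<And>y y'. y \<in> K \<Longrightarrow> y' \<in> K \<Longrightarrow> y \<sqsubset> y' \<Longrightarrow>
      \<not> colourable_in E {x \<in> F'. y \<sqsubset> x \<and> x \<sqsubset> y'} (k * c + 2 * c + 1)"
    using dense_clique[OF F'V notcol] by blast
  have KV: "K \<subseteq> V" using K(1) F'V by blast
  have finK: "finite K" by (rule finite_subset[OF KV finite_V])
  obtain y1 y2 where y: "y1 \<in> K" "y2 \<in> K" "y1 \<sqsubset> y2"
    "\<And>y. y \<in> K - {y1} \<Longrightarrow> y = y2 \<or> y2 \<sqsubset> y"
    using two_least[OF KV] K(3) k_ge_2 by blast
  define X where "X = {x \<in> {x \<in> F'. y1 \<sqsubset> x \<and> x \<sqsubset> y2}. \<forall>u\<in>K. \<not> E x u}"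
  have XF: "X \<subseteq> F'" unfolding X_def by auto
  have XV: "X \<subseteq> V" using XF F'V by blast
  have "k * c + 2 * c + 1 = (1 + 2 * c) + card K * c" using K(3) by simp
  with K(4)[OF y(1-3)]
  have "\<not> colourable_in E {x \<in> F'. y1 \<sqsubset> x \<and> x \<sqsubset> y2} ((1 + 2 * c) + card K * c)" by metis
  then have X: "\<not> colourable_in E X (1 + 2 * c)"
    unfolding X_def by (intro avoid_neighbours[OF finK KV]) (use F'V in auto)
  have Xlt: "x \<sqsubset> z" if "x \<in> X" "z \<in> K - {y1}" for x z
    using that(1) y(4)[OF that(2)] lt_trans[of x y2 z] unfolding X_def by auto
  \<comment> \<open>The edges y1 z and x s alternate and x avoids K, so a support of x beyond z must
    meet z.\<close>
  have cross_K: "E s z" if "x \<in> X" "z \<in> K - {y1}" "s \<in> V" "E s x" "z \<sqsubset> s" for x s z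
  proof -
    have "E y1 z" using K(2) y(1) that(2) unfolding is_clique_def by auto
    have "E y1 x \<or> E x z \<or> E z s"
    proof (rule cross[OF _ _ Xlt[OF that(1,2)] that(5) \<open>E y1 z\<close> E_sym[OF that(4)]])
      show "{y1, x, z, s} \<subseteq> V" using that(1,2,3) KV XV y(1) by auto
      show "y1 \<sqsubset> x" using that(1) unfolding X_def by auto
    qed
    moreover have "\<not> E y1 x" "\<not> E x z"
      using that y(1) E_sym[of y1 x] unfolding X_def by auto
    ultimately show ?thesis using E_sym[of z s] by auto
  qed
  have "X \<noteq> {}" using X colourable_empty by metis
  with XV obtain x0 where x0: "x0 \<in> X" "\<And>x. x \<in> X \<Longrightarrow> x = x0 \<or> x0 \<sqsubset> x"
    by (rule least_exists) blast
  obtain p where p: "p \<in> S'" "E p x0" using S'(2) x0(1) XF by blast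
  have pV: "p \<in> V" using p(1) S'(1) FV by blast
  have "x0 \<noteq> p" using p(2) E_irrefl[of x0] by auto
  then have "1 + 2 * c = 1 + card {x0, p} * c" by simp
  with X have "\<not> colourable_in E X (1 + card {x0, p} * c)" by metis
  then have "\<not> colourable_in E {x \<in> X. \<forall>u\<in>{x0, p}. \<not> E x u} 1"
    by (intro avoid_neighbours) (use XV x0(1) pV in auto)
  moreover have "colourable_in E {x0} 1"
    by (rule colourable_independent) (use E_irrefl in auto)
  ultimately have "\<not> {x \<in> X. \<forall>u\<in>{x0, p}. \<not> E x u} \<subseteq> {x0}"
    using colourable_mono[of E "{x0}" 1 "{x \<in> X. \<forall>u\<in>{x0, p}. \<not> E x u}" 1] by linarith
  then obtain z where z: "z \<in> X" "z \<noteq> x0" "\<not> E z x0" "\<not> E z p" by auto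
  obtain s where s: "s \<in> S" "E s z" using S(2) z(1) XF F' by blast
  have sV: "s \<in> V" using s(1) S(1) by blast
  have xz: "x0 \<sqsubset> z" using x0(2)[OF z(1)] z(2) by auto
  have zp: "z \<sqsubset> p" using S'(3) z(1) XF p(1) by auto
  have ps: "p \<sqsubset> s" using S(3) p(1) S'(1) s(1) by auto
  have "E x0 z \<or> E z p \<or> E p s"
    by (rule cross[OF _ xz zp ps E_sym[OF p(2)] E_sym[OF s(2)]]) (use x0(1) z(1) XV pV sV in auto)
  then have "E p s" using z(3,4) E_sym[of x0 z] by auto
  show False
  proof (rule clique_too_large[OF KV K(2,3) y(1) pV sV \<open>E p s\<close>])
    fix w assume w: "w \<in> K - {y1}"
    have "w \<sqsubset> p" using S'(3) K(1) w p(1) by auto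
    moreover have "w \<sqsubset> s" using S(3) K(1) w s(1) F' by auto
    ultimately show "E p w \<and> E s w"
      using cross_K[OF x0(1) w pV p(2)] cross_K[OF z(1) w sV s(2)] by simp
  qed
qed

text \<open>With no wall between l and r, all members of X have the same nearest wall, and X lies in
  its neighbourhood.\<close>

lemma same_next_wall_colourable:
  assumes "X \<subseteq> V" "S \<subseteq> V" "l \<in> V"
    and "\<And>x. x \<in> X \<Longrightarrow> l \<sqsubset> x \<and> x \<sqsubset> r"
    and next_wall: "\<forall>x\<in>X. \<exists>w\<in>S. w \<sqsubset> x \<and> E w x \<and> (\<forall>w'\<in>S. \<not> (w \<sqsubset> w' \<and> w' \<sqsubset> x))"
    and none: "\<And>w. w \<in> S \<Longrightarrow> \<not> (l \<sqsubset> w \<and> w \<sqsubset> r)"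
  shows "colourable_in E X c"
proof (cases "X = {}")
  case True
  then show ?thesis by (simp add: colourable_empty)
next
  case False
  have far: "w = l \<or> w \<sqsubset> l" if "w \<in> S" "w \<sqsubset> x" "x \<in> X" for w x
    using lt_total[of w l] none[OF that(1)] assms(4)[OF that(3)] lt_trans[of w x r] that assms(2,3)
    by auto
  from False obtain x0 where x0: "x0 \<in> X" by auto
  with next_wall obtain w0 where
    w0: "w0 \<in> S" "w0 \<sqsubset> x0" "E w0 x0" "\<forall>w'\<in>S. \<not> (w0 \<sqsubset> w' \<and> w' \<sqsubset> x0)" by auto
  show ?thesis
  proof (rule neighbourhood_colourable[of w0])
    fix x assume x: "x \<in> X"
    with next_wall obtain w where
      w: "w \<in> S" "w \<sqsubset> x" "E w x" "\<forall>w'\<in>S. \<not> (w \<sqsubset> w' \<and> w' \<sqsubset> x)" by auto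
    have "w0 \<sqsubset> x" "w \<sqsubset> x0"
      using far[OF w0(1,2) x0] far[OF w(1,2) x] assms(4)[OF x] assms(4)[OF x0]
        lt_trans[of w0 l x] lt_trans[of w l x0] by auto
    then have "w = w0" using w0(1,4) w(1,4) lt_total[of w w0] assms(2) by auto
    then show "E w0 x" using w(3) by simp
  qed (use w0(1) assms(1,2) in auto)
qed

text \<open>A later wall p is a member of F, so its nearest earlier wall w meets it. When both lie
  in the gap after y1, they separate y1 from every other clique element, and the second wall
  condition makes them meet all of these. In the constant, one c is for each side of the first
  earlier wall \<open>w0\<close> in the gap and 1 for \<open>w0\<close> itself.\<close>

lemma not_wall_supported_twice:
  assumes FV: "F \<subseteq> V" and F': "F' \<subseteq> F"
    and "wall_supported lt E V F" "wall_supported lt E F F'"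
  shows "colourable_in E F' (2 * ((2 * c + 1) + 1) * c)"
proof (rule ccontr)
  assume notcol: "\<not> ?thesis"
  have F'V: "F' \<subseteq> V" using FV F' by blast
  obtain S where S: "S \<subseteq> V"
    "\<forall>f\<in>F. \<exists>w\<in>S. w \<sqsubset> f \<and> E w f \<and> (\<forall>w'\<in>S. \<not> (w \<sqsubset> w' \<and> w' \<sqsubset> f))"
    "\<forall>a\<in>F. \<forall>b\<in>F. \<forall>w\<in>S. E a b \<longrightarrow> a \<sqsubset> w \<longrightarrow> w \<sqsubset> b \<longrightarrow> E w b"
    using assms(3) unfolding wall_supported_def by auto
  obtain S' where S': "S' \<subseteq> F"
    "\<forall>f\<in>F'. \<exists>w\<in>S'. w \<sqsubset> f \<and> E w f \<and> (\<forall>w'\<in>S'. \<not> (w \<sqsubset> w' \<and> w' \<sqsubset> f))"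
    "\<forall>a\<in>F'. \<forall>b\<in>F'. \<forall>w\<in>S'. E a b \<longrightarrow> a \<sqsubset> w \<longrightarrow> w \<sqsubset> b \<longrightarrow> E w b"
    using assms(4) unfolding wall_supported_def by auto
  obtain K where K: "K \<subseteq> F'" "is_clique E K" "card K = k"
    "\<And>y y'. y \<in> K \<Longrightarrow> y' \<in> K \<Longrightarrow> y \<sqsubset> y' \<Longrightarrow>
      \<not> colourable_in E {x \<in> F'. y \<sqsubset> x \<and> x \<sqsubset> y'} (2 * c + 1)"
    using dense_clique[OF F'V notcol] by blast
  have KV: "K \<subseteq> V" using K(1) F'V by blast
  obtain y1 y2 where y: "y1 \<in> K" "y2 \<in> K" "y1 \<sqsubset> y2"
    "\<And>y. y \<in> K - {y1} \<Longrightarrow> y = y2 \<or> y2 \<sqsubset> y"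
    using two_least[OF KV] K(3) k_ge_2 by blast
  have yV: "y1 \<in> V" "y2 \<in> V" using y KV by auto
  define X where "X = {x \<in> F'. y1 \<sqsubset> x \<and> x \<sqsubset> y2}"
  have X: "\<not> colourable_in E X (2 * c + 1)" using K(4)[OF y(1-3)] unfolding X_def .
  have XV: "X \<subseteq> V" and XF': "X \<subseteq> F'" using F'V unfolding X_def by auto
  have ne: "{w \<in> S. y1 \<sqsubset> w \<and> w \<sqsubset> y2} \<noteq> {}"
  proof
    assume "{w \<in> S. y1 \<sqsubset> w \<and> w \<sqsubset> y2} = {}"
    then have "colourable_in E X c"
      proof (intro same_next_wall_colourable[OF XV S(1) yV(1), of y2])
      show "\<forall>x\<in>X. \<exists>w\<in>S. w \<sqsubset> x \<and> E w x \<and> (\<forall>w'\<in>S. \<not> (w \<sqsubset> w' \<and> w' \<sqsubset> x))"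
        by (rule ballI, rule bspec[OF S(2)]) (use XF' F' in auto)
    qed (use X_def in auto)
    then have "colourable_in E X (2 * c + 1)" by (rule colourable_mono) auto
    with X show False ..
  qed
  have "{w \<in> S. y1 \<sqsubset> w \<and> w \<sqsubset> y2} \<subseteq> V" using S(1) by auto
  from this ne obtain w0 where "w0 \<in> {w \<in> S. y1 \<sqsubset> w \<and> w \<sqsubset> y2}"
    "\<And>w. w \<in> {w \<in> S. y1 \<sqsubset> w \<and> w \<sqsubset> y2} \<Longrightarrow> w = w0 \<or> w0 \<sqsubset> w"
    by (rule least_exists) blast
  then have w0: "w0 \<in> S" "y1 \<sqsubset> w0" "w0 \<sqsubset> y2"
    "\<And>w. w \<in> S \<Longrightarrow> y1 \<sqsubset> w \<Longrightarrow> w \<sqsubset> y2 \<Longrightarrow> w = w0 \<or> w0 \<sqsubset> w" by simp_all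
  have w0V: "w0 \<in> V" using w0(1) S(1) by auto
  \<comment> \<open>Choosing p beyond \<open>w0\<close> keeps its nearest earlier wall in the gap.
    If there were no such p, the members left of \<open>w0\<close> would share a nearest earlier
    wall and those right of it a nearest later wall.\<close>
  have "\<exists>p\<in>S'. w0 \<sqsubset> p \<and> p \<sqsubset> y2"
  proof (rule ccontr)
    assume no: "\<not> ?thesis"
    have "colourable_in E {x \<in> X. x \<sqsubset> w0} c"
    proof (rule same_next_wall_colourable[of _ S y1 w0])
      show "\<not> (y1 \<sqsubset> w \<and> w \<sqsubset> w0)" if "w \<in> S" for w
        using w0(4)[OF that] lt_trans[of w w0 y2] w0(3) lt_asym[of w w0] lt_irrefl[of w0] by auto
    show "{x \<in> X. x \<sqsubset> w0} \<subseteq> V" using XV by auto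
      show "\<forall>x\<in>{x \<in> X. x \<sqsubset> w0}. \<exists>w\<in>S. w \<sqsubset> x \<and> E w x \<and> (\<forall>w'\<in>S. \<not> (w \<sqsubset> w' \<and> w' \<sqsubset> x))"
        by (rule ballI, rule bspec[OF S(2)]) (use XF' F' in auto)
    qed (use S(1) yV X_def in auto)
    moreover have "colourable_in E {x \<in> X. w0 \<sqsubset> x} c"
    proof (rule same_next_wall_colourable[of _ S' w0 y2])
      show "{x \<in> X. w0 \<sqsubset> x} \<subseteq> V" using XV by auto
      show "S' \<subseteq> V" using S'(1) FV by auto
      show "\<forall>x\<in>{x \<in> X. w0 \<sqsubset> x}. \<exists>w\<in>S'. w \<sqsubset> x \<and> E w x \<and> (\<forall>w'\<in>S'. \<not> (w \<sqsubset> w' \<and> w' \<sqsubset> x))"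
        by (rule ballI, rule bspec[OF S'(2)]) (use XF' in auto)
    qed (use w0V no X_def in auto)
    ultimately have "colourable_in E ({x \<in> X. x \<sqsubset> w0} \<union> {x \<in> X. w0 \<sqsubset> x}) (c + c)"
      by (rule colourable_Un)
    moreover have "colourable_in E {w0} 1"
      by (rule colourable_independent) (use E_irrefl in auto)
    ultimately have col:
      "colourable_in E ({x \<in> X. x \<sqsubset> w0} \<union> {x \<in> X. w0 \<sqsubset> x} \<union> {w0}) (c + c + 1)"
      by (rule colourable_Un)
    have "x \<sqsubset> w0 \<or> w0 \<sqsubset> x \<or> x = w0" if "x \<in> X" for x
      using lt_total[of x w0] w0V XV that by auto
    then have sub: "X \<subseteq> {x \<in> X. x \<sqsubset> w0} \<union> {x \<in> X. w0 \<sqsubset> x} \<union> {w0}" by auto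
    have "colourable_in E X (2 * c + 1)" by (rule colourable_mono[OF col sub]) simp
    with X show False ..
  qed
  then obtain p where p: "p \<in> S'" "w0 \<sqsubset> p" "p \<sqsubset> y2" by auto
  have pF: "p \<in> F" using p(1) S'(1) by auto
  from bspec[OF S(2) this] obtain w where
    w: "w \<in> S" "w \<sqsubset> p" "E w p" "\<forall>w'\<in>S. \<not> (w \<sqsubset> w' \<and> w' \<sqsubset> p)" by auto
  have wV: "w \<in> V" using w(1) S(1) by auto
  have "w = w0 \<or> w0 \<sqsubset> w" using w(4) w0(1) p(2) lt_total[OF wV w0V] by auto
  then have y1w: "y1 \<sqsubset> w" using w0(2) lt_trans[of y1 w0 w] by auto
  have y1p: "y1 \<sqsubset> p" using lt_trans[OF y1w w(2)] .
  have pV: "p \<in> V" using pF FV by auto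
  show False
  proof (rule clique_too_large[OF KV K(2,3) y(1) wV pV w(3)])
    fix z assume z: "z \<in> K - {y1}"
    have "E y1 z" using K(2) y(1) z unfolding is_clique_def by auto
    have pz: "p \<sqsubset> z" using y(4)[OF z] p(3) lt_trans[of p y2 z] by auto
    have wz: "w \<sqsubset> z" using lt_trans[OF w(2) pz] .
    have "y1 \<in> F'" "z \<in> F'" using y(1) z K(1) by auto
    then show "E w z \<and> E p z"
      using bspec[OF bspec[OF bspec[OF S(3), of y1], of z] w(1)]
        bspec[OF bspec[OF bspec[OF S'(3), of y1], of z] p(1)] \<open>E y1 z\<close> y1w y1p pz wz F' by auto
  qed
qed

text \<open>All supports \<open>s f\<close> meet v, so c colours suffice for them. Supports of one
  colour are pairwise disjoint, which is what \<open>walls_crossing_right\<close> requires; n + n is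
  for its two parts.\<close>

lemma wall_class_colourable:
  assumes V: "u \<in> V" "v \<in> V" "A \<subseteq> V" "F \<subseteq> A" and uv: "E u v"
    and F: "\<And>f. f \<in> F \<Longrightarrow> u \<sqsubset> f \<and> f \<sqsubset> v \<and> \<not> E f u \<and> \<not> E f v"
    and s: "\<And>f. f \<in> F \<Longrightarrow> s f \<in> A \<and> E (s f) f \<and> u \<sqsubset> s f \<and> s f \<sqsubset> v \<and> E (s f) v"
    and left: "\<And>F'. F' \<subseteq> F \<Longrightarrow> wall_supported lt E A F' \<Longrightarrow> colourable_in E F' n"
    and right: "\<And>F'. F' \<subseteq> F \<Longrightarrow> wall_supported (\<lambda>x y. y \<sqsubset> x) E A F' \<Longrightarrow> colourable_in E F' n"
  shows "colourable_in E F (c * (n + n))"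
proof -
  have "colourable_in E (s ` F) c"
  proof (rule neighbourhood_colourable[OF V(2)])
    show "s ` F \<subseteq> V" using s V(3) by auto
    show "E v a" if "a \<in> s ` F" for a using that s E_sym[of a v] by auto
  qed
  then obtain h :: "'a \<Rightarrow> nat" where h: "\<forall>a\<in>s ` F. h a < c"
    "\<forall>a\<in>s ` F. \<forall>b\<in>s ` F. E a b \<longrightarrow> h a \<noteq> h b"
    unfolding colourable_in_def by (elim exE conjE) (rule that)
  show ?thesis
  proof (rule colourable_classes[where g = "\<lambda>f. h (s f)"])
    show "h (s f) < c" if "f \<in> F" for f using h(1) that by simp
    fix i
    define Q where "Q = {f \<in> F. h (s f) = i}"
    have QF: "Q \<subseteq> F" unfolding Q_def by auto
    have "\<exists>F1 F2. Q = F1 \<union> F2 \<and> wall_supported lt E A F1 \<and>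
        wall_supported (\<lambda>x y. y \<sqsubset> x) E A F2"
    proof (rule walls_crossing_right[where S = "s ` Q", OF V(1,2,3) _ _ uv])
      show "Q \<subseteq> A" "s ` Q \<subseteq> A" using QF V(4) s by auto
      show "u \<sqsubset> f \<and> f \<sqsubset> v \<and> \<not> E f u \<and> \<not> E f v" if "f \<in> Q" for f using F QF that by auto
      show "u \<sqsubset> t \<and> t \<sqsubset> v \<and> E t v" if "t \<in> s ` Q" for t using s QF that by auto
      show "\<not> E a b" if "a \<in> s ` Q" "b \<in> s ` Q" for a b
      proof -
        have "a \<in> s ` F" "b \<in> s ` F" "h a = h b" using that unfolding Q_def by auto
        then show ?thesis using h(2) by auto
      qed
      show "\<exists>t\<in>s ` Q. E t f" if "f \<in> Q" for f using s[of f] QF that by auto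
    qed
    then obtain F1 F2 where Q: "Q = F1 \<union> F2" "wall_supported lt E A F1"
      "wall_supported (\<lambda>x y. y \<sqsubset> x) E A F2" by (elim exE conjE) (rule that)
    have "colourable_in E (F1 \<union> F2) (n + n)"
      by (rule colourable_Un[OF left right]) (use Q QF in auto)
    then show "colourable_in E {f \<in> F. h (s f) = i} (n + n)" using Q(1) Q_def by simp
  qed
qed

section \<open>Five levels of supports\<close>

text \<open>Encodes the four kinds of support as elements of a finite type, so that they can be
  counted in the pigeonhole argument.\<close>

definition supported :: "bool \<times> bool \<Rightarrow> 'a set \<Rightarrow> 'a set \<Rightarrow> bool" where
  "supported t A F \<longleftrightarrow> (if fst t then wall_supported else out_supported)
     (if snd t then (\<lambda>x y. x \<sqsubset> y) else (\<lambda>x y. y \<sqsubset> x)) E A F"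

text \<open>For an edge u v, n + n pays for supports beyond either end, the two terms c * (n + n)
  for inner supports meeting v or u, and 2 * c for the neighbours of u and v. The inner factor 2,
  the + 1 and the last c come from \<open>dense_clique\<close>, the outermost 2 from the layers of
  the search.\<close>

definition level_bound :: "nat \<Rightarrow> nat" where
  "level_bound n = 2 * (2 * ((n + n + (c * (n + n) + c * (n + n)) + 2 * c) + 1) * c)"

text \<open>Only one edge u v of a dense clique is used. The members in its gap that avoid u and v
  are sorted by where their supports lie; guarding ensures that each support meets u or v, so those
  inside the gap fall under \<open>wall_class_colourable\<close>, directly or after
  reflection.\<close>

lemma colourable_by_supported:
  assumes AV: "A \<subseteq> V"
    and col: "\<And>F t. F \<subseteq> A \<Longrightarrow> supported t A F \<Longrightarrow> colourable_in E F n"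
  shows "colourable_in E A (level_bound n)"
  unfolding level_bound_def
proof (rule colourable_by_guarded[OF AV])
  show "1 \<le> 2 * ((n + n + (c * (n + n) + c * (n + n)) + 2 * c) + 1) * c"
    using c_ge_1 by simp
  fix F S assume FA: "F \<subseteq> A" and SA: "S \<subseteq> A" and guards: "guards S F"
  have FV: "F \<subseteq> V" and SV: "S \<subseteq> V" using FA SA AV by auto
  let ?b = "n + n + (c * (n + n) + c * (n + n))"
  show "colourable_in E F (2 * ((?b + 2 * c) + 1) * c)"
  proof (rule ccontr)
    assume notcol: "\<not> ?thesis"
    obtain K where K: "K \<subseteq> F" "is_clique E K" "card K = k"
      "\<And>y y'. y \<in> K \<Longrightarrow> y' \<in> K \<Longrightarrow> y \<sqsubset> y' \<Longrightarrow>
        \<not> colourable_in E {x \<in> F. y \<sqsubset> x \<and> x \<sqsubset> y'} (?b + 2 * c)"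
      using dense_clique[OF FV notcol] by blast
    have KV: "K \<subseteq> V" using K(1) FV by auto
    have card_K: "2 \<le> card K" using K(3) k_ge_2 by simp
    obtain u v where uK: "u \<in> K" "v \<in> K" and lt_uv: "u \<sqsubset> v"
      by (rule two_least[OF KV card_K]) blast
    have uF: "u \<in> F" "v \<in> F" and uV: "u \<in> V" "v \<in> V" using uK K(1) FV by auto
    have "u \<noteq> v" using lt_uv lt_irrefl[of u] by auto
    then have uv: "E u v" using K(2) uK unfolding is_clique_def by auto
    define X where "X = {x \<in> {x \<in> F. u \<sqsubset> x \<and> x \<sqsubset> v}. \<forall>w\<in>{u, v}. \<not> E x w}"
    have "?b + 2 * c = ?b + card {u, v} * c" using \<open>u \<noteq> v\<close> by simp
    with K(4)[OF uK lt_uv]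
    have "\<not> colourable_in E {x \<in> F. u \<sqsubset> x \<and> x \<sqsubset> v} (?b + card {u, v} * c)" by metis
    then have X: "\<not> colourable_in E X ?b"
      unfolding X_def by (intro avoid_neighbours) (use uV FV in auto)
    have XF: "x \<in> F \<and> u \<sqsubset> x \<and> x \<sqsubset> v \<and> \<not> E x u \<and> \<not> E x v" if "x \<in> X" for x
      using that unfolding X_def by auto
    have XA: "X \<subseteq> A" using XF FA by auto
    have "\<forall>x\<in>X. \<exists>s. s \<in> S \<and> E s x" using guards XF unfolding guards_def by auto
    from bchoice[OF this] obtain s where s: "\<forall>x\<in>X. s x \<in> S \<and> E (s x) x" ..
    have exits: "E (s x) u \<or> E (s x) v" if "x \<in> X" for x
      proof (rule guards_exit[OF guards _ uF])
      show "s x \<in> S" "E (s x) x" using s that by auto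
    qed (use XF[OF that] uv in auto)
    have s_ne: "s x \<noteq> u" "s x \<noteq> v" if "x \<in> X" for x
      using s XF[OF that] that E_sym[of "s x" x] by auto
    define X1 where "X1 = {x \<in> X. s x \<sqsubset> u}"
    define X2 where "X2 = {x \<in> X. v \<sqsubset> s x}"
    define X3 where "X3 = {x \<in> X. u \<sqsubset> s x \<and> s x \<sqsubset> v \<and> E (s x) v}"
    define X4 where "X4 = {x \<in> X. u \<sqsubset> s x \<and> s x \<sqsubset> v \<and> E (s x) u}"
    interpret m: critical_ray_graph V "\<lambda>x y. y \<sqsubset> x" E k c by (rule mirror_critical)
    have "out_supported (\<lambda>x y. y \<sqsubset> x) E A X1"
      unfolding out_supported_def
    proof (intro exI[of _ "s ` X1"] conjI ballI)
      show "s ` X1 \<subseteq> A" using s SA unfolding X1_def by auto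
      show "\<exists>t\<in>s ` X1. E t f" if "f \<in> X1" for f using that s unfolding X1_def by auto
      show "t \<sqsubset> f" if "f \<in> X1" "t \<in> s ` X1" for f t
        using that lt_trans[of t u f] XF[of f] unfolding X1_def by auto
    qed
    then have X1: "colourable_in E X1 n"
      by (intro col[of _ "(False, False)"]) (use XA in \<open>auto simp: supported_def X1_def\<close>)
    have "out_supported lt E A X2"
      unfolding out_supported_def
    proof (intro exI[of _ "s ` X2"] conjI ballI)
      show "s ` X2 \<subseteq> A" using s SA unfolding X2_def by auto
      show "\<exists>t\<in>s ` X2. E t f" if "f \<in> X2" for f using that s unfolding X2_def by auto
      show "f \<sqsubset> t" if "f \<in> X2" "t \<in> s ` X2" for f t
        using that lt_trans[of f v t] XF[of f] unfolding X2_def by auto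
    qed
    then have X2: "colourable_in E X2 n"
      by (intro col[of _ "(False, True)"]) (use XA in \<open>auto simp: supported_def X2_def\<close>)
    have wall_l: "colourable_in E F' n" if "F' \<subseteq> A" "wall_supported lt E A F'" for F'
      by (rule col[of _ "(True, True)"]) (use that in \<open>auto simp: supported_def\<close>)
    have wall_r: "colourable_in E F' n" if "F' \<subseteq> A" "wall_supported (\<lambda>x y. y \<sqsubset> x) E A F'" for F'
      by (rule col[of _ "(True, False)"]) (use that in \<open>auto simp: supported_def\<close>)
    have X3: "colourable_in E X3 (c * (n + n))"
    proof (rule wall_class_colourable[where s = s, OF uV AV _ uv])
      show "X3 \<subseteq> A" using XA unfolding X3_def by auto
      show "u \<sqsubset> f \<and> f \<sqsubset> v \<and> \<not> E f u \<and> \<not> E f v" if "f \<in> X3" for f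
        using that XF[of f] unfolding X3_def by auto
      show "s f \<in> A \<and> E (s f) f \<and> u \<sqsubset> s f \<and> s f \<sqsubset> v \<and> E (s f) v" if "f \<in> X3" for f
        using that s SA unfolding X3_def by auto
      show "colourable_in E F' n" if "F' \<subseteq> X3" "wall_supported lt E A F'" for F'
        by (rule wall_l[OF _ that(2)]) (use that(1) XA in \<open>auto simp: X3_def\<close>)
      show "colourable_in E F' n" if "F' \<subseteq> X3" "wall_supported (\<lambda>x y. y \<sqsubset> x) E A F'" for F'
        by (rule wall_r[OF _ that(2)]) (use that(1) XA in \<open>auto simp: X3_def\<close>)
    qed
    have X4: "colourable_in E X4 (c * (n + n))"
    proof (rule m.wall_class_colourable[where s = s, OF uV(2,1) AV _ E_sym[OF uv]])
      show "X4 \<subseteq> A" using XA unfolding X4_def by auto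
      show "f \<sqsubset> v \<and> u \<sqsubset> f \<and> \<not> E f v \<and> \<not> E f u" if "f \<in> X4" for f
        using that XF[of f] unfolding X4_def by auto
      show "s f \<in> A \<and> E (s f) f \<and> s f \<sqsubset> v \<and> u \<sqsubset> s f \<and> E (s f) u" if "f \<in> X4" for f
        using that s SA unfolding X4_def by auto
      show "colourable_in E F' n" if "F' \<subseteq> X4" "wall_supported lt E A F'" for F'
        by (rule wall_l[OF _ that(2)]) (use that(1) XA in \<open>auto simp: X4_def\<close>)
      show "colourable_in E F' n" if "F' \<subseteq> X4" "wall_supported (\<lambda>x y. y \<sqsubset> x) E A F'" for F'
        by (rule wall_r[OF _ that(2)]) (use that(1) XA in \<open>auto simp: X4_def\<close>)
    qed
    have "x \<in> X1 \<or> x \<in> X2 \<or> x \<in> X3 \<or> x \<in> X4" if "x \<in> X" for x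
    proof -
      have "s x \<in> V" using s that SV by auto
      then have "s x \<sqsubset> u \<or> u \<sqsubset> s x" "s x \<sqsubset> v \<or> v \<sqsubset> s x"
        using lt_total[of "s x" u] lt_total[of "s x" v] uV s_ne[OF that] by auto
      then show ?thesis using exits[OF that] that X1_def X2_def X3_def X4_def by auto
    qed
    then have sub: "X \<subseteq> (X1 \<union> X2) \<union> (X3 \<union> X4)" by auto
    have "colourable_in E ((X1 \<union> X2) \<union> (X3 \<union> X4)) ?b"
      by (rule colourable_Un[OF colourable_Un[OF X1 X2] colourable_Un[OF X3 X4]])
    then have "colourable_in E X ?b" by (rule colourable_mono[OF _ sub]) simp
    with X show False ..
  qed
qed

text \<open>The bound for a repeated support from outside; it dominates the one for repeated
  walls.\<close>

definition base_bound :: nat where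
  "base_bound = 2 * ((k * c + 2 * c + 1) + 1) * c"

lemma not_supported_twice:
  assumes "F \<subseteq> V" "F' \<subseteq> F" "supported t V F" "supported t F F'"
  shows "colourable_in E F' base_bound"
proof -
  interpret m: critical_ray_graph V "\<lambda>x y. y \<sqsubset> x" E k c by (rule mirror_critical)
  have le: "2 * ((2 * c + 1) + 1) * c \<le> base_bound" unfolding base_bound_def by simp
  show ?thesis
  proof (cases "fst t")
    case wall: True
    have "colourable_in E F' (2 * ((2 * c + 1) + 1) * c)"
    proof (cases "snd t")
      case True
      then show ?thesis
        using not_wall_supported_twice[OF assms(1,2)] assms(3,4) wall by (simp add: supported_def)
    next
      case False
      then show ?thesis
        using m.not_wall_supported_twice[OF assms(1,2)] assms(3,4) wall by (simp add: supported_def)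
    qed
    then show ?thesis by (rule colourable_mono[OF _ order_refl le])
  next
    case out: False
    show ?thesis
    proof (cases "snd t")
      case True
      then show ?thesis
        using not_out_supported_twice[OF assms(1,2)] assms(3,4) out
        by (simp add: supported_def base_bound_def)
    next
      case False
      then show ?thesis
        using m.not_out_supported_twice[OF assms(1,2)] assms(3,4) out
        by (simp add: supported_def base_bound_def)
    qed
  qed
qed

text \<open>Transfers the kinds recorded at earlier levels to the current subfamily, with all
  supports regarded as taken from V.\<close>

lemma supported_mono:
  assumes "supported t A F" "A \<subseteq> B" "G \<subseteq> F"
  shows "supported t B G"
proof (cases "fst t")
  case True
  have "wall_supported l E B G" if w: "wall_supported l E A F" for l
  proof -
    obtain S where S: "S \<subseteq> A"
      "\<forall>f\<in>F. \<exists>w\<in>S. l w f \<and> E w f \<and> (\<forall>w'\<in>S. \<not> (l w w' \<and> l w' f))"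
      "\<forall>a\<in>F. \<forall>b\<in>F. \<forall>w\<in>S. E a b \<longrightarrow> l a w \<longrightarrow> l w b \<longrightarrow> E w b"
      using w unfolding wall_supported_def by (elim exE conjE) (rule that)
    show ?thesis
      unfolding wall_supported_def
    proof (intro exI[of _ S] conjI)
      show "S \<subseteq> B" using S(1) assms(2) by (rule subset_trans)
      show "\<forall>f\<in>G. \<exists>w\<in>S. l w f \<and> E w f \<and> (\<forall>w'\<in>S. \<not> (l w w' \<and> l w' f))"
        by (rule ballI) (rule bspec[OF S(2) subsetD[OF assms(3)]])
      show "\<forall>a\<in>G. \<forall>b\<in>G. \<forall>w\<in>S. E a b \<longrightarrow> l a w \<longrightarrow> l w b \<longrightarrow> E w b"
        using S(3) assms(3) by (meson subsetD)
    qed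
  qed
  then show ?thesis using assms(1) True unfolding supported_def by simp
next
  case False
  have "out_supported l E B G" if w: "out_supported l E A F" for l
  proof -
    obtain S where S: "S \<subseteq> A" "\<forall>f\<in>F. \<exists>s\<in>S. E s f" "\<forall>f\<in>F. \<forall>s\<in>S. l f s"
      using w unfolding out_supported_def by (elim exE conjE) (rule that)
    show ?thesis
      unfolding out_supported_def
    proof (intro exI[of _ S] conjI)
      show "S \<subseteq> B" using S(1) assms(2) by (rule subset_trans)
      show "\<forall>f\<in>G. \<exists>s\<in>S. E s f" by (rule ballI) (rule bspec[OF S(2) subsetD[OF assms(3)]])
      show "\<forall>f\<in>G. \<forall>s\<in>S. l f s" by (rule ballI) (rule bspec[OF S(3) subsetD[OF assms(3)]])
    qed
  qed
  then show ?thesis using assms(1) False unfolding supported_def by simp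
qed

lemma le_level_bound: "n \<le> level_bound n"
proof -
  have "n \<le> n * c" using c_ge_1 by simp
  also have "\<dots> \<le> level_bound n" unfolding level_bound_def by (simp add: algebra_simps)
  finally show ?thesis .
qed

lemma base_bound_le: "base_bound \<le> (level_bound ^^ m) base_bound"
  by (induction m) (use le_level_bound order_trans in auto)

text \<open>T holds the kinds not seen so far. A level either repeats a kind outside T, which
  \<open>not_supported_twice\<close> bounds, or removes a kind from T. The extra \<open>Suc\<close>
  is the level that must repeat a kind once T is empty.\<close>

lemma colourable_all_types:
  assumes "finite T" "F \<subseteq> V" "\<And>t. t \<notin> T \<Longrightarrow> supported t V F"
  shows "colourable_in E F ((level_bound ^^ Suc (card T)) base_bound)"
  using assms
proof (induction "card T" arbitrary: T F rule: less_induct)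
  case less
  have "colourable_in E F (level_bound ((level_bound ^^ card T) base_bound))"
  proof (rule colourable_by_supported[OF less.prems(2)])
    fix F' t assume F': "F' \<subseteq> F" "supported t F F'"
    show "colourable_in E F' ((level_bound ^^ card T) base_bound)"
    proof (cases "t \<in> T")
      case False
      have "colourable_in E F' base_bound"
        by (rule not_supported_twice[OF less.prems(2) F'(1) less.prems(3)[OF False] F'(2)])
      then show ?thesis by (rule colourable_mono[OF _ order_refl base_bound_le])
    next
      case True
      then have card: "card T = Suc (card (T - {t}))"
        using card_Suc_Diff1[OF less.prems(1)] by simp
      have "colourable_in E F' ((level_bound ^^ Suc (card (T - {t}))) base_bound)"
      proof (rule less.hyps)
        show "card (T - {t}) < card T" using card by simp
        show "finite (T - {t})" using less.prems(1) by simp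
        show "F' \<subseteq> V" using F'(1) less.prems(2) by (rule subset_trans)
        show "supported r V F'" if "r \<notin> T - {t}" for r
        proof (cases "r = t")
          case True
          then show ?thesis using supported_mono[OF F'(2) less.prems(2) order_refl] by simp
        next
          case False
          then have "supported r V F" using that less.prems(3) by simp
          then show ?thesis by (rule supported_mono[OF _ order_refl F'(1)])
        qed
      qed
      then show ?thesis using card by simp
    qed
  qed
  then show ?case by simp
qed

lemma colourable_V: "colourable_in E V ((level_bound ^^ Suc (card (UNIV :: (bool \<times> bool) set))) base_bound)"
  by (rule colourable_all_types) auto

end

section \<open>Induction on the clique number\<close>

text \<open>The number n is chosen before the graph, so the induction hypothesis applies to all
  subgraphs with one bound. Clique numbers 0 and 1 are treated directly, since the critical setting
  needs 2 \<le> k.\<close>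

lemma ordered_ray_graph_chi_bounded:
  "\<exists>n. \<forall>(V :: 'a set) lt E. ordered_ray_graph V lt E \<longrightarrow>
     (\<forall>K\<subseteq>V. is_clique E K \<longrightarrow> card K \<le> k) \<longrightarrow> colourable_in E V n"
proof (induction k)
  case 0
  have "colourable_in E V 0"
    if "ordered_ray_graph V lt E" and K: "\<forall>K\<subseteq>V. is_clique E K \<longrightarrow> card K \<le> 0"
    for V :: "'a set" and lt E
  proof -
    have "v \<notin> V" for v
    proof
      assume "v \<in> V"
      then have "card {v} \<le> 0" using K by (auto simp: is_clique_def)
      then show False by simp
    qed
    then have "V = {}" by auto
    then show ?thesis by (simp add: colourable_empty)
  qed
  then show ?case by (intro exI[of _ 0]) auto
next
  case (Suc k)
  then obtain c where c: "\<And>(V :: 'a set) lt E. ordered_ray_graph V lt E \<Longrightarrow>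
      (\<forall>K\<subseteq>V. is_clique E K \<longrightarrow> card K \<le> k) \<Longrightarrow> colourable_in E V c" by auto
  show ?case
  proof (cases "k = 0")
    case True
    have "colourable_in E V 1"
      if "ordered_ray_graph V lt E" and K: "\<forall>K\<subseteq>V. is_clique E K \<longrightarrow> card K \<le> 1"
      for V :: "'a set" and lt E
    proof (rule colourable_independent)
      interpret ordered_ray_graph V lt E by (rule that(1))
      fix a b assume ab: "a \<in> V" "b \<in> V"
      show "\<not> E a b"
      proof
        assume E: "E a b"
        then have "a \<noteq> b" using E_irrefl by auto
        moreover have "card {a, b} \<le> 1"
          using K ab E E_sym[OF E] by (auto simp: is_clique_def)
        ultimately show False by simp
      qed
    qed simp
    then show ?thesis using True by (intro exI[of _ 1]) auto
  next
    case False
    define c' where "c' = max c 1"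
    \<comment> \<open>Unfolding the bounds in \<open>colourable_V\<close> exposes that they depend
      only on k and \<open>c'\<close>, so one n serves all graphs.\<close>
    have "\<exists>n. \<forall>(V :: 'a set) lt E. critical_ray_graph V lt E (Suc k) c' \<longrightarrow> colourable_in E V n"
      by (auto simp: critical_ray_graph.level_bound_def critical_ray_graph.base_bound_def
          dest!: critical_ray_graph.colourable_V)
    moreover have "critical_ray_graph V lt E (Suc k) c'"
      if G: "ordered_ray_graph V lt E" and K: "\<forall>K\<subseteq>V. is_clique E K \<longrightarrow> card K \<le> Suc k"
      for V :: "'a set" and lt E
    proof (rule critical_ray_graph.intro[OF G critical_ray_graph_axioms.intro])
      show "2 \<le> Suc k" "1 \<le> c'" using False c'_def by auto
      show "card K \<le> Suc k" if "K \<subseteq> V" "is_clique E K" for K using K that by simp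
      show "colourable_in E A c'"
        if "A \<subseteq> V" "\<And>K. K \<subseteq> A \<Longrightarrow> is_clique E K \<Longrightarrow> card K < Suc k" for A
      proof -
        have "colourable_in E A c"
          by (rule c[OF ordered_ray_graph.subgraph[OF G that(1)]])
            (use that(2) in \<open>auto simp: less_Suc_eq_le\<close>)
        then show ?thesis by (rule colourable_mono) (auto simp: c'_def)
      qed
    qed
    ultimately show ?thesis by meson
  qed
qed

section \<open>From rays to ordered graphs\<close>

text \<open>
  Here \<open>p x t\<close> is the abscissa at height \<open>t\<close> of the line spanned by the ray \<open>x\<close>, and \<open>b x\<close> is the
  height of its apex.
\<close>

locale sweep =
  fixes V :: "'a set" and lt :: "'a \<Rightarrow> 'a \<Rightarrow> bool" (infix "\<sqsubset>" 50)
    and p :: "'a \<Rightarrow> real \<Rightarrow> real" and b :: "'a \<Rightarrow> real" and E :: "'a \<Rightarrow> 'a \<Rightarrow> bool"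
  assumes fin: "finite V"
    and irrefl: "\<not> x \<sqsubset> x"
    and trans: "x \<sqsubset> y \<Longrightarrow> y \<sqsubset> z \<Longrightarrow> x \<sqsubset> z"
    and total: "x \<in> V \<Longrightarrow> y \<in> V \<Longrightarrow> x \<noteq> y \<Longrightarrow> x \<sqsubset> y \<or> y \<sqsubset> x"
    and sym: "E x y \<Longrightarrow> E y x"
    and E_irr: "\<not> E x x"
    and mono: "x \<sqsubset> y \<Longrightarrow> s \<le> t \<Longrightarrow> p y s - p x s \<le> p y t - p x t"
    and meet: "x \<in> V \<Longrightarrow> y \<in> V \<Longrightarrow> x \<sqsubset> y \<Longrightarrow>
      E x y \<longleftrightarrow> p y (max (b x) (b y)) \<le> p x (max (b x) (b y))"
begin

lemma mirror: "sweep V (\<lambda>x y. y \<sqsubset> x) (\<lambda>x t. - p x t) b E"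
proof
  show "finite V" by (rule fin)
  show "\<not> x \<sqsubset> x" for x by (rule irrefl)
  show "z \<sqsubset> x" if "y \<sqsubset> x" "z \<sqsubset> y" for x y z by (rule trans[OF that(2,1)])
  show "y \<sqsubset> x \<or> x \<sqsubset> y" if "x \<in> V" "y \<in> V" "x \<noteq> y" for x y using total[OF that] by auto
  show "E y x" if "E x y" for x y by (rule sym[OF that])
  show "\<not> E x x" for x by (rule E_irr)
  show "- p y s - - p x s \<le> - p y t - - p x t" if "y \<sqsubset> x" "s \<le> t" for x y s t
    using mono[OF that] by simp
  show "E x y \<longleftrightarrow> - p y (max (b x) (b y)) \<le> - p x (max (b x) (b y))"
    if "x \<in> V" "y \<in> V" "y \<sqsubset> x" for x y
    using meet[OF that(2,1,3)] sym[of x y] sym[of y x] by (auto simp: max.commute)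
qed

text \<open>At the height of the higher apex of u and v, v is not to the right of u. If a had
  started by then, it would be strictly between them, with u strictly to the left of v. So a starts
  above both apices, and by \<open>mono\<close> it stays strictly between the two lines.\<close>

lemma trapped:
  assumes V: "{u, a, v} \<subseteq> V" and ua: "u \<sqsubset> a" and av: "a \<sqsubset> v"
    and uv: "E u v" and nu: "\<not> E u a" and nv: "\<not> E a v"
  shows "b u < b a" "b v < b a" "\<And>t. b a \<le> t \<Longrightarrow> p u t < p a t \<and> p a t < p v t"
proof -
  let ?M = "max (b u) (b v)"
  have V3: "u \<in> V" "a \<in> V" "v \<in> V" using V by auto
  have m: "p v ?M \<le> p u ?M" using meet[OF V3(1,3) trans[OF ua av]] uv by simp
  have n1: "p u (max (b u) (b a)) < p a (max (b u) (b a))" using meet[OF V3(1,2) ua] nu by simp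
  have n2: "p a (max (b a) (b v)) < p v (max (b a) (b v))" using meet[OF V3(2,3) av] nv by simp
  have "?M < b a"
  proof (rule ccontr)
    assume "\<not> ?M < b a"
    then have "max (b u) (b a) \<le> ?M" "max (b a) (b v) \<le> ?M" by auto
    from mono[OF ua this(1)] mono[OF av this(2)] show False using m n1 n2 by linarith
  qed
  then show ba: "b u < b a" "b v < b a" by auto
  then have "max (b u) (b a) = b a" "max (b a) (b v) = b a" by auto
  then show "p u t < p a t \<and> p a t < p v t" if "b a \<le> t" for t
    using mono[OF ua that] mono[OF av that] n1 n2 by simp
qed

text \<open>If all three contacts failed, x would be trapped between a and c. Where x meets d, at
  the higher of their apices, d is then left of c, and by \<open>mono\<close> also lower down, so c
  and d would meet.\<close>

lemma sweep_cross:
  assumes V: "{a, x, c, d} \<subseteq> V" and ax: "a \<sqsubset> x" and xc: "x \<sqsubset> c" and cd: "c \<sqsubset> d"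
    and ac: "E a c" and xd: "E x d"
  shows "E a x \<or> E x c \<or> E c d"
proof (rule ccontr)
  assume "\<not> ?thesis"
  then have n: "\<not> E a x" "\<not> E x c" "\<not> E c d" by auto
  have V4: "a \<in> V" "x \<in> V" "c \<in> V" "d \<in> V" using V by auto
  have bc: "b c < b x" and lo: "\<And>t. b x \<le> t \<Longrightarrow> p x t < p c t"
    using trapped[of a x c] V4 ax xc ac n by auto
  let ?t = "max (b x) (b d)"
  have "p d ?t \<le> p x ?t" using meet[OF V4(2,4) trans[OF xc cd]] xd by simp
  moreover have "p x ?t < p c ?t" by (rule lo) simp
  moreover have "p d (max (b c) (b d)) - p c (max (b c) (b d)) \<le> p d ?t - p c ?t"
    by (rule mono[OF cd]) (use bc in auto)
  ultimately show False using meet[OF V4(3,4) cd] n(3) by simp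
qed

text \<open>At the height where a and w' are compared, w' is not right of a. If w has started by
  then, it is left of w' and hence meets a. If w starts higher, it meets v there, which puts w'
  beyond v; by \<open>mono\<close> w' is already beyond v at the lower height, although a is still
  left of v.\<close>

lemma sweep_wall_next_right:
  assumes V: "{u, a, w, w', v} \<subseteq> V" and "u \<sqsubset> a" "a \<sqsubset> w" "w \<sqsubset> w'" "w' \<sqsubset> v"
    and "E u v" "\<not> E a u" "\<not> E a v" "E w v" "\<not> E w w'" "E a w'"
  shows "E a w"
proof -
  have V5: "u \<in> V" "a \<in> V" "w \<in> V" "w' \<in> V" "v \<in> V" using V by auto
  have aw': "a \<sqsubset> w'" by (rule trans[OF assms(3,4)])
  have wv: "w \<sqsubset> v" by (rule trans[OF assms(4,5)])
  have av: "a \<sqsubset> v" by (rule trans[OF aw' assms(5)])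
  have "\<not> E u a" using assms(7) sym[of u a] by auto
  then have bv: "b v < b a" and lo: "\<And>t. b a \<le> t \<Longrightarrow> p a t < p v t"
    using trapped[of u a v] V5 assms(2,6,8) av by auto
  let ?t = "max (b a) (b w')"
  have t: "p w' ?t \<le> p a ?t" using meet[OF V5(2,4) aw'] assms(11) by simp
  have n: "p w (max (b w) (b w')) < p w' (max (b w) (b w'))"
    using meet[OF V5(3,4) assms(4)] assms(10) by simp
  show ?thesis
  proof (cases "b w \<le> ?t")
    case True
    have "p w' (max (b w) (b w')) - p w (max (b w) (b w')) \<le> p w' ?t - p w ?t"
      by (rule mono[OF assms(4)]) (use True in auto)
    moreover have "p w (max (b a) (b w)) - p a (max (b a) (b w)) \<le> p w ?t - p a ?t"
      by (rule mono[OF assms(3)]) (use True in auto)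
    ultimately show ?thesis using meet[OF V5(2,3) assms(3)] t n by simp
  next
    case False
    then have "max (b w) (b w') = b w" "max (b w) (b v) = b w" using bv by auto
    then have "p v (b w) \<le> p w (b w)" "p w (b w) < p w' (b w)"
      using meet[OF V5(3,5) wv] assms(9) n by auto
    moreover have "p v ?t - p w' ?t \<le> p v (b w) - p w' (b w)"
      by (rule mono[OF assms(5)]) (use False in auto)
    moreover have "p a ?t < p v ?t" by (rule lo) simp
    ultimately show ?thesis using t by simp
  qed
qed

text \<open>The cases name the highest apex. If it is that of a, the two contacts reverse the order
  of w and w'. If it is that of a wall, the contact of this wall with v puts w' at or beyond v, and
  the contact of a and w' then contradicts that a stays left of v.\<close>

lemma sweep_wall_one_side:
  assumes V: "{u, w, a, w', v} \<subseteq> V" and "u \<sqsubset> w" "w \<sqsubset> a" "a \<sqsubset> w'" "w' \<sqsubset> v"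
    and "E u v" "\<not> E a u" "\<not> E a v" "E w v" "E w' v" "\<not> E w w'" "E w a" "E a w'"
  shows False
proof -
  have V5: "u \<in> V" "a \<in> V" "w \<in> V" "w' \<in> V" "v \<in> V" using V by auto
  have ww': "w \<sqsubset> w'" by (rule trans[OF assms(3,4)])
  have av: "a \<sqsubset> v" by (rule trans[OF assms(4,5)])
  have ua: "u \<sqsubset> a" by (rule trans[OF assms(2,3)])
  have wv: "w \<sqsubset> v" by (rule trans[OF ww' assms(5)])
  have "\<not> E u a" using assms(7) sym[of u a] by auto
  then have bv: "b v < b a" and lo: "\<And>t. b a \<le> t \<Longrightarrow> p a t < p v t"
    using trapped[of u a v] V5 assms(6,8) ua av by auto
  let ?s = "max (b w) (b a)" and ?t = "max (b a) (b w')"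
  have s: "p a ?s \<le> p w ?s" using meet[OF V5(3,2) assms(3)] assms(12) by simp
  have t: "p w' ?t \<le> p a ?t" using meet[OF V5(2,4) assms(4)] assms(13) by simp
  have n: "p w (max (b w) (b w')) < p w' (max (b w) (b w'))"
    using meet[OF V5(3,4) ww'] assms(11) by simp
  have up: "p w r < p w' r" if "max (b w) (b w') \<le> r" for r
    using mono[OF ww' that] n by simp
  have at: "p a ?t < p v ?t" by (rule lo) simp
  consider "b w \<le> b a" "b w' \<le> b a" | "b a < b w" "b w' \<le> b w" | "b a < b w'" "b w \<le> b w'"
    by linarith
  then show False
  proof cases
    case 1
    then have "?s = b a" "?t = b a" by auto
    moreover have "p w (b a) < p w' (b a)" by (rule up) (use 1 in auto)
    ultimately show False using s t by simp
  next
    case 2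
    then have "max (b w) (b v) = b w" using bv by auto
    then have "p v (b w) \<le> p w (b w)" using meet[OF V5(3,5) wv] assms(9) by simp
    moreover have "p w (b w) < p w' (b w)" by (rule up) (use 2 in auto)
    moreover have "p v ?t - p w' ?t \<le> p v (b w) - p w' (b w)"
      by (rule mono[OF assms(5)]) (use 2 in auto)
    ultimately show False using t at by simp
  next
    case 3
    then have "max (b w') (b v) = b w'" "?t = b w'" using bv by auto
    then show False using meet[OF V5(4,5) assms(5)] assms(10) t at by simp
  qed
qed

lemma ordered_ray_graph: "ordered_ray_graph V lt E"
proof
  \<comment> \<open>Reflection exchanges u and v, so walls that meet u reduce to walls that meet
    v.\<close>
  interpret m: sweep V "\<lambda>x y. y \<sqsubset> x" "\<lambda>x t. - p x t" b E by (rule mirror)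
  show "finite V" by (rule fin)
  show "\<not> x \<sqsubset> x" for x by (rule irrefl)
  show "x \<sqsubset> z" if "x \<sqsubset> y" "y \<sqsubset> z" for x y z by (rule trans[OF that])
  show "x \<sqsubset> y \<or> y \<sqsubset> x" if "x \<in> V" "y \<in> V" "x \<noteq> y" for x y by (rule total[OF that])
  show "E y x" if "E x y" for x y by (rule sym[OF that])
  show "\<not> E x x" for x by (rule E_irr)
  show "E a x \<or> E x c \<or> E c d"
    if "{a, x, c, d} \<subseteq> V" "a \<sqsubset> x" "x \<sqsubset> c" "c \<sqsubset> d" "E a c" "E x d" for a x c d
    by (rule sweep_cross[OF that])
  show "E a w"
    if "{u, a, w, w', v} \<subseteq> V" "u \<sqsubset> a" "a \<sqsubset> w" "w \<sqsubset> w'" "w' \<sqsubset> v"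
      "E u v" "\<not> E a u" "\<not> E a v" "E w v" "E w' v" "\<not> E w w'" "E a w'" for u a w w' v
    by (rule sweep_wall_next_right[OF that(1-9,11,12)])
  show "E a w"
    if "{u, a, w, w', v} \<subseteq> V" "u \<sqsubset> w'" "w' \<sqsubset> w" "w \<sqsubset> a" "a \<sqsubset> v"
      "E u v" "\<not> E a u" "\<not> E a v" "E w u" "E w' u" "\<not> E w w'" "E a w'" for u a w w' v
    by (rule m.sweep_wall_next_right[OF _ that(5,4,3,2) sym[OF that(6)] that(8,7,9,11,12)])
      (use that(1) in auto)
  show False
    if "{u, w, a, w', v} \<subseteq> V" "u \<sqsubset> w" "w \<sqsubset> a" "a \<sqsubset> w'" "w' \<sqsubset> v" "E u v" "\<not> E a u" "\<not> E a v"
      "E w v \<and> E w' v \<or> E w u \<and> E w' u" "\<not> E w w'" "E w a" "E a w'" for u w a w' v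
    using that(9)
  proof
    assume "E w v \<and> E w' v"
    then show False using sweep_wall_one_side[OF that(1-8) _ _ that(10-12)] by simp
  next
    assume wu: "E w u \<and> E w' u"
    have "\<not> E w' w" using that(10) sym[of w' w] by auto
    moreover have "{v, w', a, w, u} \<subseteq> V" using that(1) by auto
    ultimately show False
      using m.sweep_wall_one_side[OF _ that(5,4,3,2) sym[OF that(6)] that(8,7) _ _ _
        sym[OF that(12)] sym[OF that(11)]] wu by simp
  qed
qed

end

text \<open>Comparing m and then c compares positions at infinity, as m is the slope relative to the
  vertical axis; apex heights make distinct rays on a common line comparable. The adjacency is
  restricted to distinct members of V so that it is irreflexive and refers only to rays of the given
  form.\<close>

lemma half_lines_ordered_ray_graph:
  fixes X Y :: "'p \<Rightarrow> real" and m c b :: "'p set \<Rightarrow> real"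
  assumes "finite V"
    and surj: "\<And>x y. \<exists>z. X z = x \<and> Y z = y"
    and R: "\<And>R. R \<in> V \<Longrightarrow> R = {z. X z = c R + m R * Y z \<and> b R \<le> Y z}"
  shows "\<exists>lt. ordered_ray_graph V lt (\<lambda>R S. R \<in> V \<and> S \<in> V \<and> R \<noteq> S \<and> R \<inter> S \<noteq> {})"
proof -
  define lt where "lt R S \<longleftrightarrow> m R < m S \<or> m R = m S \<and> (c R < c S \<or> c R = c S \<and> b R < b S)" for R S
  have "sweep V lt (\<lambda>R t. c R + m R * t) b (\<lambda>R S. R \<in> V \<and> S \<in> V \<and> R \<noteq> S \<and> R \<inter> S \<noteq> {})"
  proof
    show "finite V" by (rule assms(1))
    show "\<not> lt R R" for R by (simp add: lt_def)
    show "lt R T" if "lt R S" "lt S T" for R S T using that unfolding lt_def by auto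
    show "lt R S \<or> lt S R" if "R \<in> V" "S \<in> V" "R \<noteq> S" for R S
    proof (rule ccontr)
      assume "\<not> ?thesis"
      then have "m R = m S" "c R = c S" "b R = b S" unfolding lt_def by auto
      then have "R = S" using R[OF that(1)] R[OF that(2)] by simp
      with that(3) show False ..
    qed
    show mono: "c S + m S * s - (c R + m R * s) \<le> c S + m S * t - (c R + m R * t)"
      if "lt R S" "s \<le> t" for R S and s t :: real
    proof -
      have "0 \<le> (m S - m R) * (t - s)" using that unfolding lt_def by (intro mult_nonneg_nonneg) auto
      then show ?thesis by (simp add: algebra_simps)
    qed
    show "(R \<in> V \<and> S \<in> V \<and> R \<noteq> S \<and> R \<inter> S \<noteq> {}) \<longleftrightarrow>
        c S + m S * max (b R) (b S) \<le> c R + m R * max (b R) (b S)"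
      if V: "R \<in> V" "S \<in> V" and lt: "lt R S" for R S
    proof
      assume "R \<in> V \<and> S \<in> V \<and> R \<noteq> S \<and> R \<inter> S \<noteq> {}"
      then obtain z where "z \<in> R" "z \<in> S" by auto
      then have "X z = c R + m R * Y z" "X z = c S + m S * Y z" "max (b R) (b S) \<le> Y z"
        using R[OF V(1)] R[OF V(2)] by auto
      then show "c S + m S * max (b R) (b S) \<le> c R + m R * max (b R) (b S)"
        using mono[OF lt, of "max (b R) (b S)" "Y z"] by simp
    next
      assume le: "c S + m S * max (b R) (b S) \<le> c R + m R * max (b R) (b S)"
      have "\<exists>t. max (b R) (b S) \<le> t \<and> c S + m S * t = c R + m R * t"
      proof (cases "m R = m S")
        case True
        then show ?thesis using lt le unfolding lt_def by (intro exI[of _ "max (b R) (b S)"]) auto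
      next
        case False
        then have pos: "0 < m S - m R" using lt unfolding lt_def by auto
        \<comment> \<open>The height at which the two lines cross; the assumption places it at or
          above the higher apex.\<close>
        define t where "t = (c R - c S) / (m S - m R)"
        have "(m S - m R) * t = c R - c S" using pos unfolding t_def by simp
        then have "c S + m S * t = c R + m R * t" by (simp add: algebra_simps)
        moreover have "max (b R) (b S) * (m S - m R) \<le> c R - c S"
          using le by (simp only: algebra_simps)
        then have "max (b R) (b S) \<le> t" using pos unfolding t_def by (simp only: pos_le_divide_eq)
        ultimately show ?thesis by auto
      qed
      then obtain t where t: "max (b R) (b S) \<le> t" "c S + m S * t = c R + m R * t" by auto
      obtain z where "X z = c R + m R * t" "Y z = t" using surj by blast
      then have "z \<in> R" "z \<in> S" using t R[OF V(1)] R[OF V(2)] by auto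
      moreover have "R \<noteq> S" using lt unfolding lt_def by auto
      ultimately show "R \<in> V \<and> S \<in> V \<and> R \<noteq> S \<and> R \<inter> S \<noteq> {}" using V by auto
    qed
  qed auto
  then show ?thesis using sweep.ordered_ray_graph by blast
qed

section \<open>Rays in the plane and the four directions\<close>

text \<open>Leaving the coordinates X and Y open lets one argument serve all four directions.
  Writing X as a function of Y covers vertical lines and excludes horizontal ones.\<close>

definition upward :: "('p \<Rightarrow> real) \<Rightarrow> ('p \<Rightarrow> real) \<Rightarrow> 'p set \<Rightarrow> bool" where
  "upward X Y R \<longleftrightarrow> (\<exists>m c b. R = {z. X z = c + m * Y z \<and> b \<le> Y z})"

lemma ray_upward:
  fixes X Y :: "'v::real_vector \<Rightarrow> real"
  assumes lin: "linear X" "linear Y" and inj: "\<And>z w. X z = X w \<Longrightarrow> Y z = Y w \<Longrightarrow> z = w"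
    and pos: "0 < Y d"
  shows "upward X Y {p + t *\<^sub>R d | t. t \<ge> 0}"
proof -
  define m where "m = X d / Y d"
  have md: "m * Y d = X d" using pos by (simp add: m_def)
  have XY: "X (p + t *\<^sub>R d) = X p + t * X d" "Y (p + t *\<^sub>R d) = Y p + t * Y d" for t
    using lin by (simp_all add: linear_add linear_scale)
  have "{p + t *\<^sub>R d | t. t \<ge> 0} = {z. X z = (X p - m * Y p) + m * Y z \<and> Y p \<le> Y z}"
  proof (intro set_eqI iffI)
    fix z assume "z \<in> {p + t *\<^sub>R d | t. t \<ge> 0}"
    then obtain t where t: "z = p + t *\<^sub>R d" "t \<ge> 0" by auto
    have "m * (Y p + t * Y d) = m * Y p + t * X d" by (simp add: md[symmetric] algebra_simps)
    then show "z \<in> {z. X z = (X p - m * Y p) + m * Y z \<and> Y p \<le> Y z}"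
      using t(2) pos by (simp add: t(1) XY)
  next
    fix z assume "z \<in> {z. X z = (X p - m * Y p) + m * Y z \<and> Y p \<le> Y z}"
    then have z: "X z = X p + m * (Y z - Y p)" "Y p \<le> Y z" by (simp_all add: algebra_simps)
    define t where "t = (Y z - Y p) / Y d"
    have t: "t * Y d = Y z - Y p" using pos by (simp add: t_def)
    have "t * X d = m * (t * Y d)" by (simp add: md[symmetric])
    then have "X z = X (p + t *\<^sub>R d)" "Y z = Y (p + t *\<^sub>R d)" using z(1) t by (simp_all add: XY)
    then have "z = p + t *\<^sub>R d" by (rule inj)
    moreover have "t \<ge> 0" using z(2) pos by (simp add: t_def)
    ultimately show "z \<in> {p + t *\<^sub>R d | t. t \<ge> 0}" by auto
  qed
  then show ?thesis unfolding upward_def by blast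
qed

text \<open>A nonzero direction has a nonzero coordinate, which with the appropriate sign serves as
  the height.\<close>

lemma ray_upward_some_direction:
  fixes R :: "(real ^ 2) set"
  assumes "ray R"
  shows "upward (\<lambda>z. z $ 1) (\<lambda>z. z $ 2) R \<or> upward (\<lambda>z. z $ 1) (\<lambda>z. - z $ 2) R \<or>
    upward (\<lambda>z. z $ 2) (\<lambda>z. z $ 1) R \<or> upward (\<lambda>z. z $ 2) (\<lambda>z. - z $ 1) R"
proof -
  obtain p d :: "real ^ 2" where d: "d \<noteq> 0" and R: "R = {p + t *\<^sub>R d | t. t \<ge> 0}"
    using assms unfolding ray_def by auto
  have lin: "linear (\<lambda>z :: real ^ 2. z $ i)" "linear (\<lambda>z :: real ^ 2. - z $ i)" for i
    by (auto intro!: linearI)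
  have inj: "z = w" if "z $ 1 = w $ 1" "z $ 2 = w $ 2" for z w :: "real ^ 2"
    using that by (simp add: vec_eq_iff forall_2)
  have "0 < d $ 2 \<or> 0 < - d $ 2 \<or> 0 < d $ 1 \<or> 0 < - d $ 1"
    using d by (auto simp: vec_eq_iff forall_2)
  then show ?thesis
  proof (elim disjE)
    assume "0 < d $ 2"
    then have "upward (\<lambda>z. z $ 1) (\<lambda>z. z $ 2) R"
      unfolding R by (intro ray_upward lin) (auto intro: inj)
    then show ?thesis by simp
  next
    assume "0 < - d $ 2"
    then have "upward (\<lambda>z. z $ 1) (\<lambda>z. - z $ 2) R"
      unfolding R by (intro ray_upward lin) (auto intro: inj)
    then show ?thesis by simp
  next
    assume "0 < d $ 1"
    then have "upward (\<lambda>z. z $ 2) (\<lambda>z. z $ 1) R"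
      unfolding R by (intro ray_upward lin) (auto intro: inj)
    then show ?thesis by simp
  next
    assume "0 < - d $ 1"
    then have "upward (\<lambda>z. z $ 2) (\<lambda>z. - z $ 1) R"
      unfolding R by (intro ray_upward lin) (auto intro: inj)
    then show ?thesis by simp
  qed
qed

lemma upward_ordered_ray_graph:
  fixes X Y :: "'p \<Rightarrow> real"
  assumes "finite V" and surj: "\<And>x y. \<exists>z. X z = x \<and> Y z = y"
    and up: "\<And>R. R \<in> V \<Longrightarrow> upward X Y R"
  shows "\<exists>lt. ordered_ray_graph V lt (\<lambda>R S. R \<in> V \<and> S \<in> V \<and> R \<noteq> S \<and> R \<inter> S \<noteq> {})"
proof -
  have "\<forall>R\<in>V. \<exists>q :: real \<times> real \<times> real.
      R = {z. X z = fst q + fst (snd q) * Y z \<and> snd (snd q) \<le> Y z}"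
    using up unfolding upward_def by (metis fst_conv snd_conv)
  from bchoice[OF this] obtain q :: "'p set \<Rightarrow> real \<times> real \<times> real" where
    q: "\<forall>R\<in>V. R = {z. X z = fst (q R) + fst (snd (q R)) * Y z \<and> snd (snd (q R)) \<le> Y z}" ..
  show ?thesis
    by (rule half_lines_ordered_ray_graph[OF assms(1) surj bspec[OF q]])
qed

lemma coordinates_surj:
  "\<exists>z :: real ^ 2. z $ 1 = x \<and> z $ 2 = y" "\<exists>z :: real ^ 2. z $ 1 = x \<and> - z $ 2 = y"
  "\<exists>z :: real ^ 2. z $ 2 = x \<and> z $ 1 = y" "\<exists>z :: real ^ 2. z $ 2 = x \<and> - z $ 1 = y"
proof -
  have *: "\<exists>z :: real ^ 2. z $ 1 = s \<and> z $ 2 = t" for s t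
    by (rule exI[of _ "vector [s, t]"]) simp
  show "\<exists>z :: real ^ 2. z $ 1 = x \<and> z $ 2 = y" by (rule *)
  show "\<exists>z :: real ^ 2. z $ 1 = x \<and> - z $ 2 = y" using *[of x "- y"] by (metis minus_minus)
  show "\<exists>z :: real ^ 2. z $ 2 = x \<and> z $ 1 = y" using *[of y x] by auto
  show "\<exists>z :: real ^ 2. z $ 2 = x \<and> - z $ 1 = y" using *[of "- y" x] by (metis minus_minus)
qed

lemma card_le_clique_number:
  assumes "finite (pverts G)" "clique_in G K"
  shows "card K \<le> clique_number G"
proof -
  have "{card K | K. clique_in G K} \<subseteq> card ` Pow (pverts G)" unfolding clique_in_def by auto
  then have "finite {card K | K. clique_in G K}" by (rule finite_subset) (use assms(1) in simp)
  then show ?thesis unfolding clique_number_def by (rule Max_ge) (use assms(2) in auto)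
qed

theorem corollary1p2:
  shows "chi_bounded {intersection_graph \<F> | \<F> :: (real ^ 2) set set. finite \<F> \<and> (\<forall>R\<in>\<F>. ray R)}"
proof -
  have "\<forall>k. \<exists>n. \<forall>(V :: (real ^ 2) set set) lt E. ordered_ray_graph V lt E \<longrightarrow>
      (\<forall>K\<subseteq>V. is_clique E K \<longrightarrow> card K \<le> k) \<longrightarrow> colourable_in E V n"
    using ordered_ray_graph_chi_bounded by (rule allI)
  from choice[OF this] obtain N :: "nat \<Rightarrow> nat" where
    N: "\<forall>k. \<forall>(V :: (real ^ 2) set set) lt E. ordered_ray_graph V lt E \<longrightarrow>
      (\<forall>K\<subseteq>V. is_clique E K \<longrightarrow> card K \<le> k) \<longrightarrow> colourable_in E V (N k)" ..
  have "chromatic_number (intersection_graph \<F>) \<le> (\<lambda>k. (N k + N k) + (N k + N k))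
      (clique_number (intersection_graph \<F>))"
    if fin: "finite \<F>" and rays: "\<forall>R\<in>\<F>. ray R" for \<F> :: "(real ^ 2) set set"
  proof -
    define G where "G = intersection_graph \<F>"
    define k where "k = clique_number G"
    \<comment> \<open>Each class below has its own adjacency restricted to its members;
      \<open>I\<close> is one relation for all four, as adding palettes requires.\<close>
    define I :: "(real ^ 2) set \<Rightarrow> (real ^ 2) set \<Rightarrow> bool"
      where "I R S \<longleftrightarrow> R \<noteq> S \<and> R \<inter> S \<noteq> {}" for R S
    have class_col: "colourable_in I {R \<in> \<F>. upward X Y R} (N k)"
      if surj: "\<And>x y. \<exists>z. X z = x \<and> Y z = y" for X Y :: "real ^ 2 \<Rightarrow> real"
    proof -
      define V where "V = {R \<in> \<F>. upward X Y R}"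
      define E where "E = (\<lambda>R S. R \<in> V \<and> S \<in> V \<and> R \<noteq> S \<and> R \<inter> S \<noteq> {})"
      have "finite V" using fin by (simp add: V_def)
      then have "\<exists>lt. ordered_ray_graph V lt E"
        unfolding E_def by (rule upward_ordered_ray_graph[OF _ surj]) (simp add: V_def)
      then obtain lt where lt: "ordered_ray_graph V lt E" ..
      have "card K \<le> k" if "K \<subseteq> V" "is_clique E K" for K
      proof -
        have "K \<subseteq> \<F>" using that(1) V_def by auto
        moreover have "u \<noteq> v \<longrightarrow> u \<inter> v \<noteq> {}" if "u \<in> K" "v \<in> K" for u v
          using \<open>is_clique E K\<close> that unfolding is_clique_def E_def by simp
        ultimately have "clique_in G K"
          unfolding clique_in_def G_def intersection_graph_def by auto
        then show ?thesis unfolding k_def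
          by (rule card_le_clique_number[rotated]) (simp add: G_def intersection_graph_def fin)
      qed
      then have "\<forall>K\<subseteq>V. is_clique E K \<longrightarrow> card K \<le> k" by (intro allI impI)
      then have "colourable_in E V (N k)"
        by (rule N[THEN spec, THEN spec, THEN spec, THEN spec, THEN mp, THEN mp, OF lt])
      then obtain f :: "(real ^ 2) set \<Rightarrow> nat" where
        f: "\<forall>R\<in>V. f R < N k" "\<forall>R\<in>V. \<forall>S\<in>V. E R S \<longrightarrow> f R \<noteq> f S"
        unfolding colourable_in_def by (elim exE conjE) (rule that)
      have "\<forall>R\<in>V. \<forall>S\<in>V. I R S \<longrightarrow> f R \<noteq> f S" using f(2) unfolding E_def I_def by simp
      with f(1) show ?thesis unfolding colourable_in_def V_def[symmetric] by (intro exI[of _ f] conjI)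
    qed
    note cols = class_col[OF coordinates_surj(1)] class_col[OF coordinates_surj(2)]
      class_col[OF coordinates_surj(3)] class_col[OF coordinates_surj(4)]
    \<comment> \<open>Every ray lies in at least one of the four classes, and a ray in several of
      them takes its colour from one palette.\<close>
    have "colourable_in I \<F> ((N k + N k) + (N k + N k))"
      by (rule colourable_mono[OF colourable_Un[OF colourable_Un[OF cols(1,2)]
        colourable_Un[OF cols(3,4)]] _ order_refl])
        (use rays ray_upward_some_direction in auto)
    then obtain f :: "(real ^ 2) set \<Rightarrow> nat" where
      f: "\<forall>R\<in>\<F>. f R < (N k + N k) + (N k + N k)"
        "\<forall>R\<in>\<F>. \<forall>S\<in>\<F>. I R S \<longrightarrow> f R \<noteq> f S"
      unfolding colourable_in_def by (elim exE conjE) (rule that)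
    have "f ` pverts G \<subseteq> {..<(N k + N k) + (N k + N k)} \<and> proper_colouring G f"
      using f unfolding proper_colouring_def G_def intersection_graph_def I_def by auto
    then have "chromatic_number G \<le> (N k + N k) + (N k + N k)"
      unfolding chromatic_number_def by (intro Least_le exI[of _ f])
    then show ?thesis by (simp add: G_def k_def)
  qed
  then show ?thesis
    unfolding chi_bounded_def
    by (intro exI[of _ "\<lambda>k. (N k + N k) + (N k + N k)"] ballI) (elim CollectE exE conjE, simp only:)
qed

end
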